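(* (i) Let $R$ be a ring such that every simple $R$-module $S$ has an infinite endomorphism ring $\mathrm{End}_R(S)$. Then every $R$-module with only finitely many submodules is distributive. (ii) Let $R$ be a semiperfect (left and right) noetherian ring. Then every $R$-module with only finitely many submodules can be written as a direct sum of a finite module and a distributive module.
   Context: Rings are associative with unity (not necessarily commutative); modules are left modules. A module $M$ is called distributive if its lattice of submodules (with meet given by intersection and join given by sum) is a distributive lattice. A finite module is one with finitely many elements. A ring $R$ is semiperfect if $R/J$ is semisimple, where $J$ is the Jacobson radical of $R$, and idempotents lift modulo $J$. *)

theory Defs
  imports "HOL-Algebra.QuotRing" "HOL-Algebra.Module"
begin

(* HOL-Algebra's locale module requires a commutative ring of scalars. The locale submodule does
   not, and is used below as it stands. *)
locale left_module = R?: ring R + M?: abelian_group M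
  for R (structure) and M :: "('r, 'm, 'x) module_scheme" (structure) +
  assumes smult_closed [simp, intro]:
      "\<lbrakk>a \<in> carrier R; x \<in> carrier M\<rbrakk> \<Longrightarrow> a \<odot>\<^bsub>M\<^esub> x \<in> carrier M"
    and smult_l_distr:
      "\<lbrakk>a \<in> carrier R; b \<in> carrier R; x \<in> carrier M\<rbrakk> \<Longrightarrow>
      (a \<oplus> b) \<odot>\<^bsub>M\<^esub> x = a \<odot>\<^bsub>M\<^esub> x \<oplus>\<^bsub>M\<^esub> b \<odot>\<^bsub>M\<^esub> x"
    and smult_r_distr:
      "\<lbrakk>a \<in> carrier R; x \<in> carrier M; y \<in> carrier M\<rbrakk> \<Longrightarrow>
      a \<odot>\<^bsub>M\<^esub> (x \<oplus>\<^bsub>M\<^esub> y) = a \<odot>\<^bsub>M\<^esub> x \<oplus>\<^bsub>M\<^esub> a \<odot>\<^bsub>M\<^esub> y"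
    and smult_assoc1:
      "\<lbrakk>a \<in> carrier R; b \<in> carrier R; x \<in> carrier M\<rbrakk> \<Longrightarrow>
      (a \<otimes> b) \<odot>\<^bsub>M\<^esub> x = a \<odot>\<^bsub>M\<^esub> (b \<odot>\<^bsub>M\<^esub> x)"
    and smult_one [simp]:
      "x \<in> carrier M \<Longrightarrow> \<one> \<odot>\<^bsub>M\<^esub> x = x"

definition distributive_module ::
    "('r, 'e) ring_scheme \<Rightarrow> ('r, 'm, 'x) module_scheme \<Rightarrow> bool" where
  "distributive_module R M \<longleftrightarrow>
    (\<forall>A B C. submodule A R M \<longrightarrow> submodule B R M \<longrightarrow> submodule C R M \<longrightarrow>
       A \<inter> (B <+>\<^bsub>M\<^esub> C) = (A \<inter> B) <+>\<^bsub>M\<^esub> (A \<inter> C))"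

definition simple_module ::
    "('r, 'e) ring_scheme \<Rightarrow> ('r, 'm, 'x) module_scheme \<Rightarrow> bool" where
  "simple_module R M \<longleftrightarrow>
    carrier M \<noteq> {\<zero>\<^bsub>M\<^esub>} \<and> (\<forall>N. submodule N R M \<longrightarrow> N = {\<zero>\<^bsub>M\<^esub>} \<or> N = carrier M)"

(* Endomorphisms are extensional functions (undefined outside the carrier), so that each one is
   represented exactly once. *)
definition endo_ring ::
    "('r, 'e) ring_scheme \<Rightarrow> ('r, 'm, 'x) module_scheme \<Rightarrow> ('m \<Rightarrow> 'm) ring" where
  "endo_ring R M =
    \<lparr>carrier = {f \<in> carrier M \<rightarrow>\<^sub>E carrier M.
        (\<forall>x\<in>carrier M. \<forall>y\<in>carrier M. f (x \<oplus>\<^bsub>M\<^esub> y) = f x \<oplus>\<^bsub>M\<^esub> f y) \<and>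
        (\<forall>a\<in>carrier R. \<forall>x\<in>carrier M. f (a \<odot>\<^bsub>M\<^esub> x) = a \<odot>\<^bsub>M\<^esub> f x)},
     mult = (\<lambda>f g. compose (carrier M) f g),
     one = (\<lambda>x\<in>carrier M. x),
     zero = (\<lambda>x\<in>carrier M. \<zero>\<^bsub>M\<^esub>),
     add = (\<lambda>f g. \<lambda>x\<in>carrier M. f x \<oplus>\<^bsub>M\<^esub> g x)\<rparr>"

definition internal_direct_sum ::
    "('r, 'e) ring_scheme \<Rightarrow> ('r, 'm, 'x) module_scheme \<Rightarrow> 'm set \<Rightarrow> 'm set \<Rightarrow> bool" where
  "internal_direct_sum R M A B \<longleftrightarrow>
    submodule A R M \<and> submodule B R M \<and> A <+>\<^bsub>M\<^esub> B = carrier M \<and> A \<inter> B = {\<zero>\<^bsub>M\<^esub>}"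

definition semisimple_module ::
    "('r, 'e) ring_scheme \<Rightarrow> ('r, 'm, 'x) module_scheme \<Rightarrow> bool" where
  "semisimple_module R M \<longleftrightarrow>
    (\<forall>A. submodule A R M \<longrightarrow> (\<exists>B. internal_direct_sum R M A B))"

definition noetherian_module ::
    "('r, 'e) ring_scheme \<Rightarrow> ('r, 'm, 'x) module_scheme \<Rightarrow> bool" where
  "noetherian_module R M \<longleftrightarrow>
    (\<forall>C :: nat \<Rightarrow> 'm set. (\<forall>n. submodule (C n) R M \<and> C n \<subseteq> C (Suc n)) \<longrightarrow>
       (\<exists>n. \<forall>k\<ge>n. C k = C n))"

definition regular_module :: "('r, 'e) ring_scheme \<Rightarrow> ('r, 'r) module" where
  "regular_module R =
    \<lparr>carrier = carrier R, mult = mult R, one = one R, zero = zero R, add = add R,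
     smult = mult R\<rparr>"

definition opposite_ring :: "('r, 'e) ring_scheme \<Rightarrow> ('r, 'e) ring_scheme" where
  "opposite_ring R = R\<lparr>mult := (\<lambda>x y. y \<otimes>\<^bsub>R\<^esub> x)\<rparr>"

(* HOL-Algebra's ideal is two-sided, hence so are its maximalideal and noetherian_ring. *)
definition left_ideal :: "'r set \<Rightarrow> ('r, 'e) ring_scheme \<Rightarrow> bool" where
  "left_ideal I R \<longleftrightarrow> submodule I R (regular_module R)"

definition maximal_left_ideal :: "'r set \<Rightarrow> ('r, 'e) ring_scheme \<Rightarrow> bool" where
  "maximal_left_ideal I R \<longleftrightarrow> left_ideal I R \<and> I \<noteq> carrier R \<and>
    (\<forall>K. left_ideal K R \<longrightarrow> I \<subseteq> K \<longrightarrow> K = I \<or> K = carrier R)"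

definition jacobson_radical :: "('r, 'e) ring_scheme \<Rightarrow> 'r set" where
  "jacobson_radical R = carrier R \<inter> \<Inter> {I. maximal_left_ideal I R}"

definition semisimple_ring :: "('r, 'e) ring_scheme \<Rightarrow> bool" where
  "semisimple_ring R \<longleftrightarrow> semisimple_module R (regular_module R)"

definition left_noetherian_ring :: "('r, 'e) ring_scheme \<Rightarrow> bool" where
  "left_noetherian_ring R \<longleftrightarrow> noetherian_module R (regular_module R)"

definition right_noetherian_ring :: "('r, 'e) ring_scheme \<Rightarrow> bool" where
  "right_noetherian_ring R \<longleftrightarrow> left_noetherian_ring (opposite_ring R)"

definition idempotents_lift_modulo :: "('r, 'e) ring_scheme \<Rightarrow> 'r set \<Rightarrow> bool" where
  "idempotents_lift_modulo R I \<longleftrightarrow>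
    (\<forall>x\<in>carrier R. x \<otimes>\<^bsub>R\<^esub> x \<ominus>\<^bsub>R\<^esub> x \<in> I \<longrightarrow>
       (\<exists>e\<in>carrier R. e \<otimes>\<^bsub>R\<^esub> e = e \<and> e \<ominus>\<^bsub>R\<^esub> x \<in> I))"

definition semiperfect_ring :: "('r, 'e) ring_scheme \<Rightarrow> bool" where
  "semiperfect_ring R \<longleftrightarrow>
    semisimple_ring (R Quot (jacobson_radical R)) \<and>
    idempotents_lift_modulo R (jacobson_radical R)"

lemma (in ring) regular_module_left_module: "left_module R (regular_module R)"
proof -
  have "abelian_group (regular_module R)"
    by (rule abelian_groupI) (auto simp: regular_module_def a_ac intro: l_neg a_inv_closed)
  then show ?thesis
    by (intro left_module.intro left_module_axioms.intro ring_axioms)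
       (auto simp: regular_module_def l_distr r_distr m_assoc)
qed

lemma opposite_ring_ring: assumes "ring R" shows "ring (opposite_ring R)"
proof -
  interpret ring R by fact
  have "abelian_group (opposite_ring R)"
    by (rule abelian_groupI) (auto simp: opposite_ring_def a_ac intro: l_neg a_inv_closed)
  moreover have "monoid (opposite_ring R)"
    by (rule monoidI) (auto simp: opposite_ring_def m_assoc)
  ultimately show ?thesis
    by (intro ringI) (auto simp: opposite_ring_def l_distr r_distr abelian_group.axioms)
qed

lemma (in left_module) cyclic_submodule:
  assumes "s \<in> carrier M" shows "submodule ((\<lambda>r. r \<odot>\<^bsub>M\<^esub> s) ` carrier R) R M"
proof -
  let ?N = "(\<lambda>r. r \<odot>\<^bsub>M\<^esub> s) ` carrier R"
  have sub: "?N \<subseteq> carrier M" using assms by auto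
  have add: "x \<oplus>\<^bsub>M\<^esub> y \<in> ?N" if xy: "x \<in> ?N" "y \<in> ?N" for x y
  proof -
    obtain a b where "a \<in> carrier R" "b \<in> carrier R" "x = a \<odot>\<^bsub>M\<^esub> s" "y = b \<odot>\<^bsub>M\<^esub> s"
      using xy by auto
    then show ?thesis using smult_l_distr[of a b s] assms
      by (intro image_eqI[of _ _ "a \<oplus> b"]) auto
  qed
  have zero: "\<zero> \<odot>\<^bsub>M\<^esub> s = \<zero>\<^bsub>M\<^esub>"
    using smult_l_distr[of \<zero> \<zero> s] assms
    by (metis M.add.r_cancel_one' R.l_zero R.zero_closed smult_closed)
  have inv: "\<ominus>\<^bsub>M\<^esub> x \<in> ?N" if x: "x \<in> ?N" for x
  proof -
    obtain a where a: "a \<in> carrier R" "x = a \<odot>\<^bsub>M\<^esub> s" using x by auto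
    have "(\<ominus> a) \<odot>\<^bsub>M\<^esub> s \<oplus>\<^bsub>M\<^esub> x = \<zero>\<^bsub>M\<^esub>"
      using smult_l_distr[of "\<ominus> a" a s] a assms zero by (simp add: R.l_neg)
    then have "\<ominus>\<^bsub>M\<^esub> x = (\<ominus> a) \<odot>\<^bsub>M\<^esub> s"
      using a assms by (intro M.minus_equality) auto
    then show ?thesis using a by auto
  qed
  have smul: "r \<odot>\<^bsub>M\<^esub> x \<in> ?N" if rx: "r \<in> carrier R" "x \<in> ?N" for r x
  proof -
    obtain a where a: "a \<in> carrier R" "x = a \<odot>\<^bsub>M\<^esub> s" using rx by auto
    then show ?thesis using smult_assoc1[of r a s] assms rx
      by (intro image_eqI[of _ _ "r \<otimes> a"]) auto
  qed
  have "subgroup ?N (add_monoid M)"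
  proof (rule M.add.subgroupI)
    show "?N \<subseteq> carrier M" by (fact sub)
    show "?N \<noteq> {}" by auto
    show "\<And>a. a \<in> ?N \<Longrightarrow> \<ominus>\<^bsub>M\<^esub> a \<in> ?N" by (rule inv)
    show "\<And>a b. a \<in> ?N \<Longrightarrow> b \<in> ?N \<Longrightarrow> a \<oplus>\<^bsub>M\<^esub> b \<in> ?N" by (rule add)
  qed
  then show ?thesis
    by (intro submodule.intro submodule_axioms.intro) (auto intro: smul)
qed

lemma submodule_subset: "submodule N R M \<Longrightarrow> N \<subseteq> carrier M"
  by (drule submodule.axioms(1), drule subgroup.subset) simp

(* A variable bound inside a statement ranges over modules with carrier in one fixed type.
   Every simple module is isomorphic to a quotient of R by a maximal left ideal, so the simple
   modules with carrier in 'r set represent all isomorphism classes of simple R-modules, and a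
   condition on endomorphism rings imposed on them holds for simple modules of every type. *)
lemma simple_modules_on_coset_type_suffice:
  fixes R :: "('r, 'e) ring_scheme" and S :: "('r, 's, 'x) module_scheme"
  assumes hyp: "\<And>T :: ('r, 'r set) module.
      left_module R T \<Longrightarrow> simple_module R T \<Longrightarrow> infinite (carrier (endo_ring R T))"
    and S: "left_module R S" "simple_module R S"
  shows "infinite (carrier (endo_ring R S))"
proof -
  interpret S: left_module R S by fact
  have "\<zero>\<^bsub>S\<^esub> \<in> carrier S" by simp
  then obtain s where s: "s \<in> carrier S" "s \<noteq> \<zero>\<^bsub>S\<^esub>"
    using S(2) unfolding simple_module_def by blast
  have "s \<in> (\<lambda>r. r \<odot>\<^bsub>S\<^esub> s) ` carrier R"
    using s by (intro image_eqI[of _ _ "\<one>\<^bsub>R\<^esub>"]) auto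
  then have gen: "(\<lambda>r. r \<odot>\<^bsub>S\<^esub> s) ` carrier R = carrier S"
    using S(2) S.cyclic_submodule[OF s(1)] s(2) unfolding simple_module_def by blast
  define h where "h x = {r \<in> carrier R. r \<odot>\<^bsub>S\<^esub> s = x}" for x
  have inj: "inj_on h (carrier S)"
  proof (rule inj_onI)
    fix x y assume x: "x \<in> carrier S" and eq: "h x = h y"
    have "x \<in> (\<lambda>r. r \<odot>\<^bsub>S\<^esub> s) ` carrier R" using gen x by simp
    then obtain r where r: "r \<in> carrier R" "r \<odot>\<^bsub>S\<^esub> s = x" by auto
    then have "r \<in> h x" by (simp add: h_def)
    then have "r \<in> h y" by (simp only: eq)
    then show "x = y" using r by (simp add: h_def)
  qed
  define k where "k = inv_into (carrier S) h"
  have kh [simp]: "k (h x) = x" if "x \<in> carrier S" for x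
    unfolding k_def using inj that by (rule inv_into_f_f)
  define T :: "('r, 'r set) module" where "T =
    \<lparr>carrier = h ` carrier S, mult = (\<lambda>A B. A), one = {}, zero = h \<zero>\<^bsub>S\<^esub>,
     add = (\<lambda>A B. h (k A \<oplus>\<^bsub>S\<^esub> k B)), smult = (\<lambda>r A. h (r \<odot>\<^bsub>S\<^esub> k A))\<rparr>"
  have T [simp]: "carrier T = h ` carrier S" "\<zero>\<^bsub>T\<^esub> = h \<zero>\<^bsub>S\<^esub>"
    "A \<oplus>\<^bsub>T\<^esub> B = h (k A \<oplus>\<^bsub>S\<^esub> k B)" "r \<odot>\<^bsub>T\<^esub> A = h (r \<odot>\<^bsub>S\<^esub> k A)" for A B r
    by (simp_all add: T_def)
  have T_group: "abelian_group T"
  proof (rule abelian_groupI)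
    fix A assume "A \<in> carrier T"
    then obtain x where "x \<in> carrier S" "A = h x" by auto
    then show "\<exists>B\<in>carrier T. B \<oplus>\<^bsub>T\<^esub> A = \<zero>\<^bsub>T\<^esub>"
      by (intro bexI[of _ "h (\<ominus>\<^bsub>S\<^esub> x)"]) (auto simp: S.M.l_neg)
  qed (auto simp: S.M.a_ac)
  then have T_module: "left_module R T"
    by (intro left_module.intro left_module_axioms.intro S.R.ring_axioms)
       (auto simp: S.smult_l_distr S.smult_r_distr S.smult_assoc1)
  interpret T: left_module R T by (fact T_module)
  have T_simple: "simple_module R T"
    unfolding simple_module_def
  proof (intro conjI allI impI)
    have "h s \<noteq> h \<zero>\<^bsub>S\<^esub>" using inj s by (auto dest: inj_onD)
    then show "carrier T \<noteq> {\<zero>\<^bsub>T\<^esub>}" using s(1) by auto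
  next
    fix N assume N: "submodule N R T"
    interpret N: submodule N R T by (fact N)
    have NT: "N \<subseteq> h ` carrier S" using submodule_subset[OF N] by simp
    have N_add: "h (k A \<oplus>\<^bsub>S\<^esub> k B) \<in> N" if "A \<in> N" "B \<in> N" for A B
      using N.m_closed[OF that] by simp
    have N_smult: "h (r \<odot>\<^bsub>S\<^esub> k A) \<in> N" if "r \<in> carrier R" "A \<in> N" for r A
      using N.smult_closed[OF that] by simp
    have N_zero: "h \<zero>\<^bsub>S\<^esub> \<in> N" using N.one_closed by simp
    have N_inv: "h (\<ominus>\<^bsub>S\<^esub> x) \<in> N" if x: "x \<in> carrier S" "h x \<in> N" for x
    proof -
      have "\<ominus>\<^bsub>T\<^esub> h x \<in> N" using N.m_inv_closed[OF x(2)] by (simp add: a_inv_def)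
      moreover have "\<ominus>\<^bsub>T\<^esub> h x = h (\<ominus>\<^bsub>S\<^esub> x)"
        using x(1) by (intro T.M.minus_equality) (auto simp: S.M.l_neg)
      ultimately show ?thesis by simp
    qed
    let ?K = "{x \<in> carrier S. h x \<in> N}"
    have "subgroup ?K (add_monoid S)"
    proof (rule S.M.add.subgroupI)
      show "?K \<noteq> {}" using N_zero by auto
      show "\<And>a. a \<in> ?K \<Longrightarrow> \<ominus>\<^bsub>S\<^esub> a \<in> ?K" using N_inv by auto
      show "a \<oplus>\<^bsub>S\<^esub> b \<in> ?K" if "a \<in> ?K" "b \<in> ?K" for a b
        using N_add[of "h a" "h b"] that by simp
    qed auto
    moreover have "r \<odot>\<^bsub>S\<^esub> x \<in> ?K" if "r \<in> carrier R" "x \<in> ?K" for r x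
      using N_smult[of r "h x"] that by simp
    ultimately have "submodule ?K R S"
      by (intro submodule.intro submodule_axioms.intro)
    then have "?K = {\<zero>\<^bsub>S\<^esub>} \<or> ?K = carrier S" using S(2) unfolding simple_module_def by blast
    moreover have "N = h ` ?K" using NT by blast
    ultimately show "N = {\<zero>\<^bsub>T\<^esub>} \<or> N = carrier T" by auto
  qed
  let ?G = "\<lambda>g. \<lambda>x\<in>carrier S. k (g (h x))"
  have inj_G: "inj_on ?G (carrier (endo_ring R T))"
  proof (rule inj_onI)
    fix f g assume f: "f \<in> carrier (endo_ring R T)" and g: "g \<in> carrier (endo_ring R T)"
      and eq: "?G f = ?G g"
    have fg: "f \<in> h ` carrier S \<rightarrow>\<^sub>E h ` carrier S" "g \<in> h ` carrier S \<rightarrow>\<^sub>E h ` carrier S"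
      using f g by (auto simp: endo_ring_def)
    show "f = g"
    proof (rule PiE_ext[OF fg])
      fix A assume "A \<in> h ` carrier S"
      then obtain x where x: "x \<in> carrier S" "A = h x" by auto
      have "f A \<in> h ` carrier S" "g A \<in> h ` carrier S" using fg x by (auto simp: PiE_iff)
      moreover have "k (f A) = k (g A)" using fun_cong[OF eq, of x] x by simp
      ultimately show "f A = g A" by auto
    qed
  qed
  have "?G g \<in> carrier (endo_ring R S)" if g: "g \<in> carrier (endo_ring R T)" for g
  proof -
    have g_in: "g \<in> h ` carrier S \<rightarrow>\<^sub>E h ` carrier S"
      and g_add: "\<And>x y. \<lbrakk>x \<in> carrier S; y \<in> carrier S\<rbrakk> \<Longrightarrow>
        g (h (x \<oplus>\<^bsub>S\<^esub> y)) = h (k (g (h x)) \<oplus>\<^bsub>S\<^esub> k (g (h y)))"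
      and g_smult: "\<And>a x. \<lbrakk>a \<in> carrier R; x \<in> carrier S\<rbrakk> \<Longrightarrow>
        g (h (a \<odot>\<^bsub>S\<^esub> x)) = h (a \<odot>\<^bsub>S\<^esub> k (g (h x)))"
      using g by (auto simp: endo_ring_def)
    have kg: "k (g (h x)) \<in> carrier S" if "x \<in> carrier S" for x
    proof -
      have "g (h x) \<in> h ` carrier S" using g_in that by (auto simp: PiE_iff)
      then show ?thesis by auto
    qed
    show ?thesis by (auto simp: endo_ring_def kg g_add g_smult)
  qed
  then have "?G ` carrier (endo_ring R T) \<subseteq> carrier (endo_ring R S)" by blast
  moreover have "infinite (?G ` carrier (endo_ring R T))"
    using hyp[OF T_module T_simple] inj_G by (simp add: finite_image_iff)
  ultimately show ?thesis by (meson finite_subset)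
qed

end

theory Submission
  imports Defs "HOL-Algebra.Ideal_Product"
begin

text \<open>
  A module is distributive as soon as any two elements \<open>x\<close>, \<open>y\<close> are comparable: \<open>1 = r + s\<close> with
  \<open>r x \<in> R y\<close> and \<open>s y \<in> R x\<close>. If this fails, some maximal left ideal \<open>P\<close> contains all \<open>r\<close> with
  \<open>r x \<in> R y\<close> and all \<open>s\<close> with \<open>s y \<in> R x\<close>, so \<open>R x + R y\<close> maps onto \<open>R / P \<oplus> R / P\<close>. The graphs
  of the endomorphisms of \<open>R / P\<close> pull back to distinct submodules, so \<open>End (R / P)\<close>, which is the
  idealizer of \<open>P\<close> modulo \<open>P\<close>, is finite.

  For the second part, \<open>R / J\<close> has a largest finite ideal, generated by a central idempotent. Lift
  it to an idempotent \<open>e\<close> of \<open>R\<close> and put \<open>f = 1 - e\<close>. Since \<open>R\<close> is left noetherian, \<open>e J / J\<^sup>2\<close> is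
  finite; its right annihilator then has finite index in \<open>R\<close> and hence contains \<open>f\<close>, so that
  \<open>e J f \<subseteq> J\<^sup>2\<close>. Dually \<open>f J e \<subseteq> J\<^sup>2\<close>. It follows that \<open>e R f\<close> and \<open>f R e\<close> lie in every power of
  \<open>J\<close>. A power of \<open>J\<close> annihilates \<open>M\<close>, so \<open>M\<close> is the direct sum of its submodules \<open>e M\<close> and \<open>f M\<close>.
  By induction along a composition series \<open>e M\<close> is finite. If two elements of \<open>f M\<close> were not
  comparable, the resulting \<open>P\<close> would contain \<open>e\<close> and \<open>R / P\<close> would have a finite endomorphism
  ring; but a corner \<open>g A g\<close> of \<open>A = R / J\<close> with \<open>g\<close> idempotent is finite only if \<open>g\<close> lies in the
  largest finite ideal.
\<close>

section \<open>Submodules and left ideals\<close>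

context left_module
begin

lemma add_diff_cancel:
  "\<lbrakk>x \<in> carrier M; y \<in> carrier M\<rbrakk> \<Longrightarrow> x \<oplus>\<^bsub>M\<^esub> y \<ominus>\<^bsub>M\<^esub> y = x"
  by (simp add: M.minus_eq M.a_assoc M.r_neg)

lemma smult_zero_left [simp]: "x \<in> carrier M \<Longrightarrow> \<zero> \<odot>\<^bsub>M\<^esub> x = \<zero>\<^bsub>M\<^esub>"
  using smult_l_distr[of \<zero> \<zero> x]
  by (metis M.add.r_cancel_one' R.l_zero R.zero_closed smult_closed)

lemma smult_zero_right [simp]: "a \<in> carrier R \<Longrightarrow> a \<odot>\<^bsub>M\<^esub> \<zero>\<^bsub>M\<^esub> = \<zero>\<^bsub>M\<^esub>"
  using smult_r_distr[of a "\<zero>\<^bsub>M\<^esub>" "\<zero>\<^bsub>M\<^esub>"]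
  by (metis M.add.r_cancel_one' M.l_zero M.zero_closed smult_closed)

lemma smult_uminus_left:
  assumes "a \<in> carrier R" "x \<in> carrier M"
  shows "(\<ominus> a) \<odot>\<^bsub>M\<^esub> x = \<ominus>\<^bsub>M\<^esub> (a \<odot>\<^bsub>M\<^esub> x)"
  using smult_l_distr[of "\<ominus> a" a x] assms
  by (intro M.minus_equality[symmetric]) (auto simp: R.l_neg)

lemma smult_diff_left:
  assumes "a \<in> carrier R" "b \<in> carrier R" "x \<in> carrier M"
  shows "(a \<ominus> b) \<odot>\<^bsub>M\<^esub> x = a \<odot>\<^bsub>M\<^esub> x \<ominus>\<^bsub>M\<^esub> b \<odot>\<^bsub>M\<^esub> x"
  using assms by (simp add: a_minus_def smult_l_distr smult_uminus_left)

text \<open>Negation is multiplication by \<open>\<ominus> \<one>\<close>, so containing zero and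
  closure under addition and scalars already give an additive subgroup.\<close>

lemma submodule_iff:
  "submodule N R M \<longleftrightarrow> N \<subseteq> carrier M \<and> \<zero>\<^bsub>M\<^esub> \<in> N \<and>
     (\<forall>x\<in>N. \<forall>y\<in>N. x \<oplus>\<^bsub>M\<^esub> y \<in> N) \<and> (\<forall>a\<in>carrier R. \<forall>x\<in>N. a \<odot>\<^bsub>M\<^esub> x \<in> N)"
  (is "_ \<longleftrightarrow> ?P")
proof
  assume N: "submodule N R M"
  interpret N: submodule N R M by fact
  show ?P
    using submodule_subset[OF N] N.m_closed N.one_closed by auto
next
  assume P: ?P
  have "\<ominus>\<^bsub>M\<^esub> x \<in> N" if "x \<in> N" for x
  proof -
    have "(\<ominus> \<one>) \<odot>\<^bsub>M\<^esub> x \<in> N" using P that by blast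
    moreover have "x \<in> carrier M" using P that by blast
    ultimately show ?thesis using smult_uminus_left[of \<one> x] by simp
  qed
  then have "subgroup N (add_monoid M)"
    using P by (intro M.add.subgroupI) auto
  then show "submodule N R M"
    using P by (intro submodule.intro submodule_axioms.intro) auto
qed

lemma submoduleD:
  assumes "submodule N R M"
  shows "\<zero>\<^bsub>M\<^esub> \<in> N" "x \<in> N \<Longrightarrow> y \<in> N \<Longrightarrow> x \<oplus>\<^bsub>M\<^esub> y \<in> N"
    "a \<in> carrier R \<Longrightarrow> x \<in> N \<Longrightarrow> a \<odot>\<^bsub>M\<^esub> x \<in> N" "x \<in> N \<Longrightarrow> x \<in> carrier M"
  using assms by (auto simp: submodule_iff)

lemma submoduleI:
  assumes "\<And>x. x \<in> N \<Longrightarrow> x \<in> carrier M" "\<zero>\<^bsub>M\<^esub> \<in> N"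
    "\<And>x y. x \<in> N \<Longrightarrow> y \<in> N \<Longrightarrow> x \<oplus>\<^bsub>M\<^esub> y \<in> N"
    "\<And>a x. a \<in> carrier R \<Longrightarrow> x \<in> N \<Longrightarrow> a \<odot>\<^bsub>M\<^esub> x \<in> N"
  shows "submodule N R M"
  using assms by (auto simp: submodule_iff)

lemma submodule_uminus:
  assumes "submodule N R M" "x \<in> N" shows "\<ominus>\<^bsub>M\<^esub> x \<in> N"
  using assms smult_uminus_left[of \<one> x] unfolding submodule_iff
  by (metis R.a_inv_closed R.one_closed smult_one subsetD)

lemma submodule_diff:
  assumes "submodule N R M" "x \<in> N" "y \<in> N" shows "x \<ominus>\<^bsub>M\<^esub> y \<in> N"
  using assms submodule_uminus[of N y] unfolding submodule_iff a_minus_def by blast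

lemma zero_submodule: "submodule {\<zero>\<^bsub>M\<^esub>} R M"
  by (auto simp: submodule_iff)

lemma carrier_submodule: "submodule (carrier M) R M"
  by (auto simp: submodule_iff)

lemma submodule_sum:
  assumes "submodule A R M" "submodule B R M"
  shows "submodule (A <+>\<^bsub>M\<^esub> B) R M"
proof -
  have sub: "A \<subseteq> carrier M" "B \<subseteq> carrier M" using assms by (auto dest: submodule_subset)
  show ?thesis
    unfolding submodule_iff
  proof (intro conjI ballI)
    show "A <+>\<^bsub>M\<^esub> B \<subseteq> carrier M" using sub by (auto simp: set_add_def')
    show "\<zero>\<^bsub>M\<^esub> \<in> A <+>\<^bsub>M\<^esub> B"
      using assms unfolding submodule_iff set_add_def' by (auto intro!: bexI[of _ "\<zero>\<^bsub>M\<^esub>"])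
  next
    fix x y assume "x \<in> A <+>\<^bsub>M\<^esub> B" "y \<in> A <+>\<^bsub>M\<^esub> B"
    then obtain a b a' b' where "a \<in> A" "b \<in> B" "a' \<in> A" "b' \<in> B"
      "x = a \<oplus>\<^bsub>M\<^esub> b" "y = a' \<oplus>\<^bsub>M\<^esub> b'" by (auto simp: set_add_def')
    moreover from this have "x \<oplus>\<^bsub>M\<^esub> y = (a \<oplus>\<^bsub>M\<^esub> a') \<oplus>\<^bsub>M\<^esub> (b \<oplus>\<^bsub>M\<^esub> b')"
      using sub by (simp add: subset_iff M.a_ac)
    moreover have "a \<oplus>\<^bsub>M\<^esub> a' \<in> A" "b \<oplus>\<^bsub>M\<^esub> b' \<in> B"
      using assms calculation unfolding submodule_iff by simp_all
    ultimately show "x \<oplus>\<^bsub>M\<^esub> y \<in> A <+>\<^bsub>M\<^esub> B"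
      unfolding set_add_def' by blast
  next
    fix r x assume r: "r \<in> carrier R" and "x \<in> A <+>\<^bsub>M\<^esub> B"
    then obtain a b where ab: "a \<in> A" "b \<in> B" "x = a \<oplus>\<^bsub>M\<^esub> b" by (auto simp: set_add_def')
    then have "r \<odot>\<^bsub>M\<^esub> x = r \<odot>\<^bsub>M\<^esub> a \<oplus>\<^bsub>M\<^esub> r \<odot>\<^bsub>M\<^esub> b"
      using sub r smult_r_distr by blast
    moreover have "r \<odot>\<^bsub>M\<^esub> a \<in> A" "r \<odot>\<^bsub>M\<^esub> b \<in> B"
      using assms ab r unfolding submodule_iff by simp_all
    ultimately show "r \<odot>\<^bsub>M\<^esub> x \<in> A <+>\<^bsub>M\<^esub> B"
      unfolding set_add_def' by blast
  qed
qed

lemma submodule_sum_upper: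
  assumes "submodule A R M" "submodule B R M"
  shows "A \<subseteq> A <+>\<^bsub>M\<^esub> B" "B \<subseteq> A <+>\<^bsub>M\<^esub> B"
proof -
  have z: "\<zero>\<^bsub>M\<^esub> \<in> A" "\<zero>\<^bsub>M\<^esub> \<in> B" using assms by (auto simp: submodule_iff)
  show "A \<subseteq> A <+>\<^bsub>M\<^esub> B"
  proof
    fix a assume a: "a \<in> A"
    then have "a = a \<oplus>\<^bsub>M\<^esub> \<zero>\<^bsub>M\<^esub>" using submodule_subset[OF assms(1)] by auto
    then show "a \<in> A <+>\<^bsub>M\<^esub> B" using a z unfolding set_add_def' by blast
  qed
  show "B \<subseteq> A <+>\<^bsub>M\<^esub> B"
  proof
    fix b assume b: "b \<in> B"
    then have "b = \<zero>\<^bsub>M\<^esub> \<oplus>\<^bsub>M\<^esub> b" using submodule_subset[OF assms(2)] by auto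
    then show "b \<in> A <+>\<^bsub>M\<^esub> B" using b z unfolding set_add_def' by blast
  qed
qed

lemma submodule_sum_least:
  assumes "submodule C R M" "A \<subseteq> C" "B \<subseteq> C"
  shows "A <+>\<^bsub>M\<^esub> B \<subseteq> C"
  using assms unfolding submodule_iff set_add_def' by blast

definition cyclic :: "'m \<Rightarrow> 'm set" where
  "cyclic x = (\<lambda>r. r \<odot>\<^bsub>M\<^esub> x) ` carrier R"

lemma submodule_cyclic: "x \<in> carrier M \<Longrightarrow> submodule (cyclic x) R M"
  unfolding cyclic_def by (rule cyclic_submodule)

lemma cyclic_self: "x \<in> carrier M \<Longrightarrow> x \<in> cyclic x"
  unfolding cyclic_def by (rule image_eqI[of _ _ \<one>]) auto

lemma cyclic_least: "submodule N R M \<Longrightarrow> x \<in> N \<Longrightarrow> cyclic x \<subseteq> N"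
  unfolding cyclic_def submodule_iff by auto

end

section \<open>Left ideals, two-sided ideals and their cosets\<close>

context ring
begin

lemma left_ideal_iff:
  "left_ideal I R \<longleftrightarrow> I \<subseteq> carrier R \<and> \<zero> \<in> I \<and>
     (\<forall>x\<in>I. \<forall>y\<in>I. x \<oplus> y \<in> I) \<and> (\<forall>a\<in>carrier R. \<forall>x\<in>I. a \<otimes> x \<in> I)"
  unfolding left_ideal_def left_module.submodule_iff[OF regular_module_left_module]
  by (simp add: regular_module_def)

lemma left_idealD:
  assumes "left_ideal I R"
  shows "\<zero> \<in> I" "x \<in> I \<Longrightarrow> y \<in> I \<Longrightarrow> x \<oplus> y \<in> I"
    "a \<in> carrier R \<Longrightarrow> x \<in> I \<Longrightarrow> a \<otimes> x \<in> I" "x \<in> I \<Longrightarrow> x \<in> carrier R"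
  using assms by (auto simp: left_ideal_iff)

lemma left_idealI:
  assumes "\<And>x. x \<in> I \<Longrightarrow> x \<in> carrier R" "\<zero> \<in> I"
    "\<And>x y. x \<in> I \<Longrightarrow> y \<in> I \<Longrightarrow> x \<oplus> y \<in> I"
    "\<And>a x. a \<in> carrier R \<Longrightarrow> x \<in> I \<Longrightarrow> a \<otimes> x \<in> I"
  shows "left_ideal I R"
  using assms by (auto simp: left_ideal_iff)

lemma left_ideal_uminus:
  assumes "left_ideal I R" "x \<in> I" shows "\<ominus> x \<in> I"
proof -
  have "(\<ominus> \<one>) \<otimes> x \<in> I" using assms by (auto simp: left_ideal_iff)
  moreover have "x \<in> carrier R" using assms by (auto simp: left_ideal_iff)
  ultimately show ?thesis by (simp add: l_minus)
qed

lemma left_ideal_diff: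
  assumes "left_ideal I R" "x \<in> I" "y \<in> I" shows "x \<ominus> y \<in> I"
  using assms left_ideal_uminus[OF assms(1,3)] unfolding left_ideal_iff a_minus_def by blast

lemma left_ideal_additive_subgroup:
  assumes "left_ideal I R" shows "additive_subgroup I R"
proof -
  have "subgroup I (add_monoid R)"
    using assms left_ideal_uminus[OF assms] by (intro add.subgroupI) (auto simp: left_ideal_iff)
  then show ?thesis by (rule additive_subgroup.intro)
qed

lemma ideal_iff:
  "ideal I R \<longleftrightarrow> left_ideal I R \<and> (\<forall>x\<in>I. \<forall>a\<in>carrier R. x \<otimes> a \<in> I)"
proof
  assume "ideal I R"
  then interpret ideal I R .
  show "left_ideal I R \<and> (\<forall>x\<in>I. \<forall>a\<in>carrier R. x \<otimes> a \<in> I)"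
    using a_subset I_l_closed I_r_closed by (auto simp: left_ideal_iff)
next
  assume I: "left_ideal I R \<and> (\<forall>x\<in>I. \<forall>a\<in>carrier R. x \<otimes> a \<in> I)"
  then have "subgroup I (add_monoid R)"
    using left_ideal_additive_subgroup additive_subgroup.a_subgroup by blast
  then show "ideal I R"
    using I by (intro idealI ring_axioms) (auto simp: left_ideal_iff)
qed

text \<open>Finite quotients are expressed below as finite sets of cosets, and this turns equality
  of cosets into membership. Stated for additive subgroups, it serves one-sided and two-sided ideals
  alike.\<close>

lemma coset_eq_iff:
  assumes "additive_subgroup I R" "a \<in> carrier R" "b \<in> carrier R"
  shows "I +> a = I +> b \<longleftrightarrow> a \<ominus> b \<in> I"
proof -
  interpret abelian_subgroup I R
    using assms(1) abelian_group_axioms by (intro abelian_subgroupI3)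
  have "a \<in> I +> b \<longleftrightarrow> a \<ominus> b \<in> I"
    using a_rcos_module_minus[OF ring_axioms assms(3,2)] .
  then show ?thesis
    using a_repr_independence[OF _ assms(3) a_subgroup] a_rcos_self[OF assms(2)] by auto
qed

text \<open>For a left ideal \<open>P\<close>, these are the \<open>a\<close> for which right
  multiplication by \<open>a\<close> is well defined on \<open>R / P\<close>.\<close>

definition idealizer :: "'a set \<Rightarrow> 'a set" where
  "idealizer P = {a \<in> carrier R. \<forall>p\<in>P. p \<otimes> a \<in> P}"

end

text \<open>On \<open>S\<close> the function \<open>f\<close> factors through \<open>g\<close>, so
  it takes no more values than \<open>g\<close>. This carries finiteness from one invariant of an
  element, such as a submodule or a coset, to another.\<close>

lemma finite_image_refine:
  assumes "finite (g ` S)"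
    and "\<And>x y. \<lbrakk>x \<in> S; y \<in> S; g x = g y\<rbrakk> \<Longrightarrow> f x = f y"
  shows "finite (f ` S)"
proof -
  have "f ` S \<subseteq> (\<lambda>z. f (SOME x. x \<in> S \<and> g x = z)) ` g ` S"
  proof
    fix u assume "u \<in> f ` S"
    then obtain x where x: "x \<in> S" "u = f x" by auto
    define y where "y = (SOME y. y \<in> S \<and> g y = g x)"
    have "y \<in> S \<and> g y = g x" unfolding y_def by (rule someI[of _ x]) (simp add: x(1))
    then have "u = f y" using assms(2)[of x y] x by simp
    then show "u \<in> (\<lambda>z. f (SOME x. x \<in> S \<and> g x = z)) ` g ` S"
      using x(1) unfolding y_def by blast
  qed
  then show ?thesis using assms(1) by (rule finite_subset[OF _ finite_imageI])
qed

section \<open>Lattices of submodules\<close>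

context left_module
begin

text \<open>This is the annihilator of the class of \<open>x\<close> in \<open>M / N\<close>,
  written without the quotient.\<close>

lemma transporter_left_ideal:
  assumes "submodule N R M" "x \<in> carrier M"
  shows "left_ideal {r \<in> carrier R. r \<odot>\<^bsub>M\<^esub> x \<in> N} R"
  using assms unfolding submodule_iff
  by (auto simp: R.left_ideal_iff smult_l_distr smult_assoc1)

text \<open>Expresses that \<open>N / N'\<close> is simple, inside the lattice of submodules, so
  that no quotient module has to be built.\<close>

definition covers :: "'m set \<Rightarrow> 'm set \<Rightarrow> bool" where
  "covers N N' \<longleftrightarrow> submodule N R M \<and> submodule N' R M \<and> N' \<subset> N \<and>
     (\<forall>K. submodule K R M \<longrightarrow> N' \<subseteq> K \<longrightarrow> K \<subseteq> N \<longrightarrow> K = N' \<or> K = N)"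

lemma coversD:
  assumes "covers N N'"
  shows "submodule N R M" "submodule N' R M" "N' \<subset> N"
    "submodule K R M \<Longrightarrow> N' \<subseteq> K \<Longrightarrow> K \<subseteq> N \<Longrightarrow> K = N' \<or> K = N"
  using assms by (simp_all add: covers_def)

text \<open>A simple quotient is generated by any nonzero element: the sum lies above
  \<open>N'\<close>, differs from it because it contains \<open>x\<close>, and stays inside
  \<open>N\<close>.\<close>

lemma covers_sum_cyclic:
  assumes "covers N N'" "x \<in> N - N'"
  shows "N' <+>\<^bsub>M\<^esub> cyclic x = N"
proof -
  note N = coversD(1)[OF assms(1)] and N' = coversD(2)[OF assms(1)]
  have x: "x \<in> carrier M" using assms(2) submodule_subset[OF N] by blast
  have cyc: "submodule (cyclic x) R M" by (rule submodule_cyclic[OF x])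
  have "submodule (N' <+>\<^bsub>M\<^esub> cyclic x) R M" by (rule submodule_sum[OF N' cyc])
  moreover have "N' \<subseteq> N' <+>\<^bsub>M\<^esub> cyclic x" by (rule submodule_sum_upper(1)[OF N' cyc])
  moreover have "x \<in> N' <+>\<^bsub>M\<^esub> cyclic x"
    using submodule_sum_upper(2)[OF N' cyc] cyclic_self[OF x] by blast
  moreover have "N' <+>\<^bsub>M\<^esub> cyclic x \<subseteq> N"
    using assms(2) coversD(3)[OF assms(1)] N by (intro submodule_sum_least cyclic_least) auto
  ultimately show ?thesis
    using coversD(4)[OF assms(1), of "N' <+>\<^bsub>M\<^esub> cyclic x"] assms(2) by blast
qed

text \<open>\<open>R / ?P\<close> is isomorphic to the simple module \<open>N / N'\<close>.
  Concretely, for \<open>k\<close> outside \<open>?P\<close> the element \<open>k x\<close> again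
  generates \<open>N\<close> over \<open>N'\<close>, which yields an \<open>r\<close> with
  \<open>1 - r k\<close> in \<open>?P\<close>.\<close>

lemma covers_transporter_maximal:
  assumes "covers N N'" "x \<in> N - N'"
  shows "maximal_left_ideal {r \<in> carrier R. r \<odot>\<^bsub>M\<^esub> x \<in> N'} R" (is "maximal_left_ideal ?P R")
proof -
  note N = coversD(1)[OF assms(1)] and N' = coversD(2)[OF assms(1)]
  have x: "x \<in> carrier M" using assms(2) submodule_subset[OF N] by blast
  have "K = ?P \<or> K = carrier R" if K: "left_ideal K R" "?P \<subseteq> K" for K
  proof (cases "K = ?P")
    case False
    then obtain k where k: "k \<in> K" "k \<in> carrier R" "k \<odot>\<^bsub>M\<^esub> x \<notin> N'"
      using K unfolding R.left_ideal_iff by blast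
    have "k \<odot>\<^bsub>M\<^esub> x \<in> N - N'" using k assms N unfolding submodule_iff by simp
    then have "x \<in> N' <+>\<^bsub>M\<^esub> cyclic (k \<odot>\<^bsub>M\<^esub> x)"
      using covers_sum_cyclic[OF assms(1)] assms(2) by blast
    then obtain n r where nr: "n \<in> N'" "r \<in> carrier R" "x = n \<oplus>\<^bsub>M\<^esub> r \<odot>\<^bsub>M\<^esub> (k \<odot>\<^bsub>M\<^esub> x)"
      by (auto simp: set_add_def' cyclic_def)
    have n: "n \<in> carrier M" using nr(1) submodule_subset[OF N'] by blast
    have "(\<one> \<ominus> r \<otimes> k) \<odot>\<^bsub>M\<^esub> x = x \<ominus>\<^bsub>M\<^esub> r \<odot>\<^bsub>M\<^esub> (k \<odot>\<^bsub>M\<^esub> x)"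
      using nr k x by (simp add: smult_diff_left smult_assoc1)
    also have "\<dots> = n"
      using add_diff_cancel[OF n, of "r \<odot>\<^bsub>M\<^esub> (k \<odot>\<^bsub>M\<^esub> x)"] nr(3)[symmetric] nr(2) k x by simp
    finally have "\<one> \<ominus> r \<otimes> k \<in> K" using K(2) nr k by auto
    moreover have "r \<otimes> k \<in> K" using K(1) nr k by (auto simp: R.left_ideal_iff)
    ultimately have "(\<one> \<ominus> r \<otimes> k) \<oplus> r \<otimes> k \<in> K" using K(1) unfolding R.left_ideal_iff by blast
    moreover have "(\<one> \<ominus> r \<otimes> k) \<oplus> r \<otimes> k = \<one>"
      using nr k by (simp add: R.minus_eq R.add.m_assoc R.l_neg)
    ultimately have "\<one> \<in> K" by simp
    then have "a \<in> K" if "a \<in> carrier R" for a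
      using K(1) that unfolding R.left_ideal_iff by (metis R.r_one)
    then show ?thesis using K(1) unfolding R.left_ideal_iff by blast
  qed simp
  moreover have "\<one> \<notin> ?P" using assms x by simp
  ultimately show ?thesis
    unfolding maximal_left_ideal_def using transporter_left_ideal[OF N' x] by blast
qed

text \<open>Finiteness provides a maximal element among the submodules above \<open>L\<close> and
  strictly inside \<open>N\<close>.\<close>

lemma covers_exists:
  assumes "finite {N. submodule N R M}" "submodule N R M" "submodule L R M" "L \<subset> N"
  obtains N' where "covers N N'" "L \<subseteq> N'"
proof -
  define S where "S = {K. submodule K R M \<and> L \<subseteq> K \<and> K \<subset> N}"
  have "finite S" unfolding S_def using assms(1) by (rule rev_finite_subset) auto
  moreover have "S \<noteq> {}" using assms by (auto simp: S_def)
  ultimately obtain N' where "N' \<in> S" and max: "\<forall>K\<in>S. N' \<subseteq> K \<longrightarrow> N' = K"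
    using finite_has_maximal[of S] by blast
  then have N': "submodule N' R M" "L \<subseteq> N'" "N' \<subset> N" by (auto simp: S_def)
  have "K = N' \<or> K = N" if K: "submodule K R M" "N' \<subseteq> K" "K \<subseteq> N" for K
  proof (cases "K = N")
    case False
    then have "K \<in> S" using K N' by (auto simp: S_def)
    then show ?thesis using max K(2) by blast
  qed simp
  then have "covers N N'" using assms(2) N' by (auto simp: covers_def)
  then show ?thesis using N'(2) by (rule that)
qed

text \<open>Induction along a composition series. The descent from \<open>N\<close> to some covered
  \<open>N'\<close> is measured by the number of submodules strictly inside
  \<open>N\<close>.\<close>

lemma submodule_induct [consumes 2, case_names zero cover]:
  assumes fin: "finite {N. submodule N R M}" and N: "submodule N R M"
    and zero: "P {\<zero>\<^bsub>M\<^esub>}"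
    and cover: "\<And>N N'. covers N N' \<Longrightarrow> P N' \<Longrightarrow> P N"
  shows "P N"
  using N
proof (induction "card {K. submodule K R M \<and> K \<subset> N}" arbitrary: N rule: less_induct)
  case less
  show ?case
  proof (cases "N = {\<zero>\<^bsub>M\<^esub>}")
    case False
    then have "{\<zero>\<^bsub>M\<^esub>} \<subset> N" using less.prems by (auto simp: submodule_iff)
    then obtain N' where N': "covers N N'"
      using covers_exists[OF fin less.prems zero_submodule] by metis
    note coversD(2,3)[OF this]
    then have "{K. submodule K R M \<and> K \<subset> N'} \<subset> {K. submodule K R M \<and> K \<subset> N}" by blast
    moreover have "finite {K. submodule K R M \<and> K \<subset> N}"
      using fin by (rule rev_finite_subset) auto
    ultimately have "card {K. submodule K R M \<and> K \<subset> N'} < card {K. submodule K R M \<and> K \<subset> N}"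
      by (intro psubset_card_mono)
    then have "P N'" using coversD(2)[OF N'] by (rule less.hyps)
    then show ?thesis by (rule cover[OF N'])
  qed (simp add: zero)
qed

end

section \<open>Distributivity\<close>

context left_module
begin

text \<open>The left ideals of all \<open>r\<close> with \<open>r x\<close> in \<open>R y\<close>
  and of all \<open>s\<close> with \<open>s y\<close> in \<open>R x\<close> add up to
  \<open>R\<close>. Over a local ring this means that one of the two cyclic submodules contains the
  other.\<close>

definition comparable :: "'m \<Rightarrow> 'm \<Rightarrow> bool" where
  "comparable x y \<longleftrightarrow> (\<exists>r\<in>carrier R. \<exists>s\<in>carrier R. r \<oplus> s = \<one> \<and>
     r \<odot>\<^bsub>M\<^esub> x \<in> cyclic y \<and> s \<odot>\<^bsub>M\<^esub> y \<in> cyclic x)"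

text \<open>For \<open>a = b + c\<close> and \<open>1 = r + s\<close> as in comparability, write
  \<open>a = s a + r a\<close>. Here \<open>r a = r b + r c\<close> lies in \<open>C\<close> because
  \<open>r b\<close> is a multiple of \<open>c\<close>, and \<open>s a\<close> lies in
  \<open>B\<close> for the symmetric reason.\<close>

lemma inter_sum_distrib:
  assumes A: "submodule A R M" and B: "submodule B R M" and C: "submodule C R M"
    and comp: "\<And>b c. b \<in> B \<Longrightarrow> c \<in> C \<Longrightarrow> comparable b c"
  shows "A \<inter> (B <+>\<^bsub>M\<^esub> C) = (A \<inter> B) <+>\<^bsub>M\<^esub> (A \<inter> C)"
proof
  show "A \<inter> B <+>\<^bsub>M\<^esub> A \<inter> C \<subseteq> A \<inter> (B <+>\<^bsub>M\<^esub> C)"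
    using submoduleD(2)[OF A] unfolding set_add_def' by blast
  show "A \<inter> (B <+>\<^bsub>M\<^esub> C) \<subseteq> (A \<inter> B) <+>\<^bsub>M\<^esub> (A \<inter> C)"
  proof
    fix a assume "a \<in> A \<inter> (B <+>\<^bsub>M\<^esub> C)"
    then obtain b c where a: "a \<in> A" and bc: "b \<in> B" "c \<in> C" "a = b \<oplus>\<^bsub>M\<^esub> c"
      by (auto simp: set_add_def')
    obtain r s where rs: "r \<in> carrier R" "s \<in> carrier R" "r \<oplus> s = \<one>"
      "r \<odot>\<^bsub>M\<^esub> b \<in> cyclic c" "s \<odot>\<^bsub>M\<^esub> c \<in> cyclic b"
      using comp[OF bc(1,2)] by (auto simp: comparable_def)
    have car: "a \<in> carrier M" "b \<in> carrier M" "c \<in> carrier M"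
      using a bc A B C by (simp_all add: submoduleD(4))
    have "r \<odot>\<^bsub>M\<^esub> a \<in> A" "s \<odot>\<^bsub>M\<^esub> a \<in> A"
      using submoduleD(3)[OF A] a rs by auto
    moreover have "r \<odot>\<^bsub>M\<^esub> a \<in> C"
    proof -
      have "r \<odot>\<^bsub>M\<^esub> b \<in> C" using rs(4) cyclic_least[OF C bc(2)] by blast
      then show ?thesis
        using bc car rs by (simp add: smult_r_distr submoduleD[OF C])
    qed
    moreover have "s \<odot>\<^bsub>M\<^esub> a \<in> B"
    proof -
      have "s \<odot>\<^bsub>M\<^esub> c \<in> B" using rs(5) cyclic_least[OF B bc(1)] by blast
      then show ?thesis
        using bc car rs by (simp add: smult_r_distr submoduleD[OF B])
    qed
    moreover have "a = s \<odot>\<^bsub>M\<^esub> a \<oplus>\<^bsub>M\<^esub> r \<odot>\<^bsub>M\<^esub> a"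
      using smult_l_distr[of r s a] rs car by (simp add: M.a_comm)
    ultimately show "a \<in> (A \<inter> B) <+>\<^bsub>M\<^esub> (A \<inter> C)"
      unfolding set_add_def' by blast
  qed
qed

section \<open>Submodules from graphs of endomorphisms of R / P\<close>

lemma submodule_left_ideal_image:
  assumes I: "left_ideal I R" and x: "x \<in> carrier M"
  shows "submodule ((\<lambda>i. i \<odot>\<^bsub>M\<^esub> x) ` I) R M"
proof (rule submoduleI)
  note D = R.left_idealD[OF I]
  show "u \<in> carrier M" if "u \<in> (\<lambda>i. i \<odot>\<^bsub>M\<^esub> x) ` I" for u
    using that D(4) x by auto
  show "\<zero>\<^bsub>M\<^esub> \<in> (\<lambda>i. i \<odot>\<^bsub>M\<^esub> x) ` I"
    using D(1) x by (intro image_eqI[of _ _ \<zero>]) auto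
  show "u \<oplus>\<^bsub>M\<^esub> v \<in> (\<lambda>i. i \<odot>\<^bsub>M\<^esub> x) ` I"
    if "u \<in> (\<lambda>i. i \<odot>\<^bsub>M\<^esub> x) ` I" "v \<in> (\<lambda>i. i \<odot>\<^bsub>M\<^esub> x) ` I" for u v
  proof -
    obtain i j where "i \<in> I" "j \<in> I" "u = i \<odot>\<^bsub>M\<^esub> x" "v = j \<odot>\<^bsub>M\<^esub> x" using \<open>u \<in> _\<close> \<open>v \<in> _\<close> by auto
    then show ?thesis
      using D x by (intro image_eqI[of _ _ "i \<oplus> j"]) (auto simp: smult_l_distr)
  qed
  show "a \<odot>\<^bsub>M\<^esub> u \<in> (\<lambda>i. i \<odot>\<^bsub>M\<^esub> x) ` I"
    if "a \<in> carrier R" "u \<in> (\<lambda>i. i \<odot>\<^bsub>M\<^esub> x) ` I" for a u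
  proof -
    obtain i where "i \<in> I" "u = i \<odot>\<^bsub>M\<^esub> x" using \<open>u \<in> _\<close> by auto
    then show ?thesis
      using D x \<open>a \<in> _\<close> by (intro image_eqI[of _ _ "a \<otimes> i"]) (auto simp: smult_assoc1)
  qed
qed

text \<open>\<open>graph_submodule P x y a\<close> is the preimage of the graph of right multiplication by \<open>a\<close> on
  \<open>R / P\<close> under the map \<open>R x + R y \<rightarrow> R / P \<oplus> R / P\<close>.\<close>

definition graph_submodule :: "'r set \<Rightarrow> 'm \<Rightarrow> 'm \<Rightarrow> 'r \<Rightarrow> 'm set" where
  "graph_submodule P x y a = {z. \<exists>r\<in>carrier R. \<exists>s\<in>carrier R.
     s \<ominus> r \<otimes> a \<in> P \<and> z = r \<odot>\<^bsub>M\<^esub> x \<oplus>\<^bsub>M\<^esub> s \<odot>\<^bsub>M\<^esub> y}"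

text \<open>The pairs \<open>(r, s)\<close> with \<open>s - r a\<close> in \<open>P\<close> form a
  submodule of \<open>R^2\<close>, and the set in question is its image under
  \<open>(r, s) \<mapsto> r x + s y\<close>.\<close>

lemma submodule_graph:
  assumes P: "left_ideal P R" and x: "x \<in> carrier M" and y: "y \<in> carrier M"
    and a: "a \<in> carrier R"
  shows "submodule (graph_submodule P x y a) R M"
proof (rule submoduleI)
  show "u \<in> carrier M" if "u \<in> graph_submodule P x y a" for u
    using that x y by (auto simp: graph_submodule_def)
  show "\<zero>\<^bsub>M\<^esub> \<in> graph_submodule P x y a"
    unfolding graph_submodule_def
    using x y a R.left_idealD(1)[OF P] by (auto intro!: bexI[of _ \<zero>] simp: R.minus_eq)
next
  fix u v assume "u \<in> graph_submodule P x y a" "v \<in> graph_submodule P x y a"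
  then obtain r s r' s' where
    rs: "r \<in> carrier R" "s \<in> carrier R" "s \<ominus> r \<otimes> a \<in> P" "u = r \<odot>\<^bsub>M\<^esub> x \<oplus>\<^bsub>M\<^esub> s \<odot>\<^bsub>M\<^esub> y"
    and rs': "r' \<in> carrier R" "s' \<in> carrier R" "s' \<ominus> r' \<otimes> a \<in> P"
      "v = r' \<odot>\<^bsub>M\<^esub> x \<oplus>\<^bsub>M\<^esub> s' \<odot>\<^bsub>M\<^esub> y"
    by (auto simp: graph_submodule_def)
  have "(s \<ominus> r \<otimes> a) \<oplus> (s' \<ominus> r' \<otimes> a) \<in> P"
    using R.left_idealD(2)[OF P rs(3) rs'(3)] .
  moreover have "(s \<ominus> r \<otimes> a) \<oplus> (s' \<ominus> r' \<otimes> a) = (s \<oplus> s') \<ominus> (r \<oplus> r') \<otimes> a"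
    using rs(1,2) rs'(1,2) a by algebra
  moreover have "u \<oplus>\<^bsub>M\<^esub> v = (r \<oplus> r') \<odot>\<^bsub>M\<^esub> x \<oplus>\<^bsub>M\<^esub> (s \<oplus> s') \<odot>\<^bsub>M\<^esub> y"
    using rs rs' x y by (simp add: smult_l_distr M.a_ac)
  ultimately show "u \<oplus>\<^bsub>M\<^esub> v \<in> graph_submodule P x y a"
    unfolding graph_submodule_def using rs(1,2) rs'(1,2)
    by (intro CollectI bexI[of _ "r \<oplus> r'"] bexI[of _ "s \<oplus> s'"]) auto
next
  fix t u assume t: "t \<in> carrier R" and "u \<in> graph_submodule P x y a"
  then obtain r s where
    rs: "r \<in> carrier R" "s \<in> carrier R" "s \<ominus> r \<otimes> a \<in> P" "u = r \<odot>\<^bsub>M\<^esub> x \<oplus>\<^bsub>M\<^esub> s \<odot>\<^bsub>M\<^esub> y"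
    by (auto simp: graph_submodule_def)
  have "t \<otimes> (s \<ominus> r \<otimes> a) \<in> P"
    using R.left_idealD(3)[OF P t rs(3)] .
  moreover have "t \<otimes> (s \<ominus> r \<otimes> a) = t \<otimes> s \<ominus> t \<otimes> r \<otimes> a"
    using rs(1,2) t a by algebra
  moreover have "t \<odot>\<^bsub>M\<^esub> u = (t \<otimes> r) \<odot>\<^bsub>M\<^esub> x \<oplus>\<^bsub>M\<^esub> (t \<otimes> s) \<odot>\<^bsub>M\<^esub> y"
    using rs t x y by (simp add: smult_r_distr smult_assoc1)
  ultimately show "t \<odot>\<^bsub>M\<^esub> u \<in> graph_submodule P x y a"
    unfolding graph_submodule_def using rs(1,2) t
    by (intro CollectI bexI[of _ "t \<otimes> r"] bexI[of _ "t \<otimes> s"]) auto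
qed

text \<open>The graph of \<open>a\<close> contains \<open>x + a y\<close>. If the graph of
  \<open>b\<close> contains it too, comparing the two expressions gives a relation between
  \<open>x\<close> and \<open>y\<close> whose coefficients lie in \<open>P\<close>; modulo
  \<open>P\<close> this leaves \<open>a = b\<close>.\<close>

lemma graph_submodule_inj:
  assumes P: "left_ideal P R" and x: "x \<in> carrier M" and y: "y \<in> carrier M"
    and Px: "\<And>r. r \<in> carrier R \<Longrightarrow> r \<odot>\<^bsub>M\<^esub> x \<in> cyclic y \<Longrightarrow> r \<in> P"
    and Py: "\<And>r. r \<in> carrier R \<Longrightarrow> r \<odot>\<^bsub>M\<^esub> y \<in> cyclic x \<Longrightarrow> r \<in> P"
    and a: "a \<in> carrier R" and b: "b \<in> R.idealizer P"
    and eq: "graph_submodule P x y a = graph_submodule P x y b"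
  shows "a \<ominus> b \<in> P"
proof -
  have bR: "b \<in> carrier R" and Pb: "\<And>p. p \<in> P \<Longrightarrow> p \<otimes> b \<in> P"
    using b by (auto simp: R.idealizer_def)
  have "x \<oplus>\<^bsub>M\<^esub> a \<odot>\<^bsub>M\<^esub> y \<in> graph_submodule P x y a"
    unfolding graph_submodule_def using a x y R.left_idealD(1)[OF P]
    by (intro CollectI bexI[of _ \<one>] bexI[of _ a]) (auto simp: R.minus_eq R.r_neg)
  then obtain r s where rs: "r \<in> carrier R" "s \<in> carrier R" "s \<ominus> r \<otimes> b \<in> P"
    "x \<oplus>\<^bsub>M\<^esub> a \<odot>\<^bsub>M\<^esub> y = r \<odot>\<^bsub>M\<^esub> x \<oplus>\<^bsub>M\<^esub> s \<odot>\<^bsub>M\<^esub> y"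
    unfolding eq by (auto simp: graph_submodule_def)
  \<comment> \<open>Equating the two expressions of \<open>x + a y\<close> shows that
    \<open>(1 - r) x\<close> lies in \<open>R y\<close> and \<open>(s - a) y\<close> in
    \<open>R x\<close>, as \<open>Px\<close> and \<open>Py\<close> require.\<close>
  have key: "(\<one> \<ominus> r) \<odot>\<^bsub>M\<^esub> x = (s \<ominus> a) \<odot>\<^bsub>M\<^esub> y"
  proof -
    have "x \<ominus>\<^bsub>M\<^esub> r \<odot>\<^bsub>M\<^esub> x
        = (x \<oplus>\<^bsub>M\<^esub> a \<odot>\<^bsub>M\<^esub> y) \<ominus>\<^bsub>M\<^esub> a \<odot>\<^bsub>M\<^esub> y \<ominus>\<^bsub>M\<^esub> r \<odot>\<^bsub>M\<^esub> x"
      using x y a rs(1) by (simp add: add_diff_cancel)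
    also have "\<dots> = s \<odot>\<^bsub>M\<^esub> y \<oplus>\<^bsub>M\<^esub> r \<odot>\<^bsub>M\<^esub> x \<ominus>\<^bsub>M\<^esub> r \<odot>\<^bsub>M\<^esub> x \<ominus>\<^bsub>M\<^esub> a \<odot>\<^bsub>M\<^esub> y"
      unfolding rs(4) using x y a rs(1,2) by (simp add: M.minus_eq M.a_ac)
    also have "\<dots> = s \<odot>\<^bsub>M\<^esub> y \<ominus>\<^bsub>M\<^esub> a \<odot>\<^bsub>M\<^esub> y"
      using x y a rs(1,2) by (simp add: add_diff_cancel)
    finally show ?thesis using x y a rs(1,2) by (simp add: smult_diff_left)
  qed
  have "\<one> \<ominus> r \<in> P"
    by (rule Px) (use key rs a in \<open>auto simp: cyclic_def\<close>)
  moreover have "s \<ominus> a \<in> P"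
    by (rule Py) (use key[symmetric] rs a in \<open>auto simp: cyclic_def\<close>)
  \<comment> \<open>Modulo \<open>P\<close>, \<open>s\<close> equals both \<open>r b\<close> and
    \<open>a\<close>, while \<open>(1 - r) b\<close> vanishes because \<open>b\<close> idealizes
    \<open>P\<close>; the combination isolates \<open>a - b\<close>.\<close>
  ultimately have "(s \<ominus> r \<otimes> b) \<ominus> (s \<ominus> a) \<ominus> (\<one> \<ominus> r) \<otimes> b \<in> P"
    by (intro R.left_ideal_diff[OF P R.left_ideal_diff[OF P rs(3)]] Pb)
  moreover have "(s \<ominus> r \<otimes> b) \<ominus> (s \<ominus> a) \<ominus> (\<one> \<ominus> r) \<otimes> b = a \<ominus> b"
    using rs(1,2) a bR by algebra
  ultimately show ?thesis by simp
qed

text \<open>\<open>N\<close> is chosen maximal below \<open>R x + R y\<close> and above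
  \<open>I x + R y\<close>, and \<open>P\<close> is the annihilator of the class of \<open>x\<close>
  modulo \<open>N\<close>. Having \<open>R y\<close> inside \<open>N\<close> puts the first
  transporter into \<open>P\<close>, and having \<open>I x\<close> inside \<open>N\<close> puts the
  second one there. Elements of the idealizer that differ modulo \<open>P\<close> have different
  graph submodules, of which there are finitely many.\<close>

lemma not_comparable_finite_idealizer:
  assumes fin: "finite {N. submodule N R M}" and x: "x \<in> carrier M" and y: "y \<in> carrier M"
    and not_comp: "\<not> comparable x y"
  obtains P where "maximal_left_ideal P R" "finite ((\<lambda>a. P +> a) ` R.idealizer P)"
    "\<And>r. r \<in> carrier R \<Longrightarrow> r \<odot>\<^bsub>M\<^esub> x \<in> cyclic y \<Longrightarrow> r \<in> P"
    "\<And>r. r \<in> carrier R \<Longrightarrow> r \<odot>\<^bsub>M\<^esub> y \<in> cyclic x \<Longrightarrow> r \<in> P"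
proof -
  note cx = submodule_cyclic[OF x] and cy = submodule_cyclic[OF y]
  define I where "I = {r \<in> carrier R. r \<odot>\<^bsub>M\<^esub> y \<in> cyclic x}"
  have I: "left_ideal I R" unfolding I_def by (rule transporter_left_ideal[OF cx y])
  define Ix where "Ix = (\<lambda>i. i \<odot>\<^bsub>M\<^esub> x) ` I"
  have Ix: "submodule Ix R M" unfolding Ix_def by (rule submodule_left_ideal_image[OF I x])
  let ?Y = "cyclic x <+>\<^bsub>M\<^esub> cyclic y" and ?L = "Ix <+>\<^bsub>M\<^esub> cyclic y"
  have Y: "submodule ?Y R M" and L: "submodule ?L R M"
    by (intro submodule_sum cx cy Ix)+
  have xY: "x \<in> ?Y" using submodule_sum_upper(1)[OF cx cy] cyclic_self[OF x] by blast
  have "Ix \<subseteq> cyclic x" unfolding Ix_def I_def cyclic_def by auto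
  then have "?L \<subseteq> ?Y"
    by (intro submodule_sum_least[OF Y] order.trans[OF _ submodule_sum_upper(1)[OF cx cy]]
          submodule_sum_upper(2)[OF cx cy])
  \<comment> \<open>If \<open>x = i x + z\<close>, then \<open>1 - i\<close> and \<open>i\<close>
    split the unit in the way that comparability demands.\<close>
  moreover have "x \<notin> ?L"
  proof
    assume "x \<in> ?L"
    then obtain i z where iz: "i \<in> I" "z \<in> cyclic y" "x = i \<odot>\<^bsub>M\<^esub> x \<oplus>\<^bsub>M\<^esub> z"
      by (auto simp: set_add_def' Ix_def)
    have i: "i \<in> carrier R" "i \<odot>\<^bsub>M\<^esub> y \<in> cyclic x" using iz(1) by (auto simp: I_def)
    have z: "z \<in> carrier M" using iz(2) submoduleD(4)[OF cy] by blast
    have "(\<one> \<ominus> i) \<odot>\<^bsub>M\<^esub> x = x \<ominus>\<^bsub>M\<^esub> i \<odot>\<^bsub>M\<^esub> x" using i x by (simp add: smult_diff_left)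
    also have "\<dots> = z"
      using add_diff_cancel[OF z, of "i \<odot>\<^bsub>M\<^esub> x"] iz(3)[symmetric] i x z
      by (simp add: M.a_comm[of z])
    finally have "(\<one> \<ominus> i) \<odot>\<^bsub>M\<^esub> x \<in> cyclic y" using iz(2) by simp
    moreover have "(\<one> \<ominus> i) \<oplus> i = \<one>" using i by (simp add: R.minus_eq R.a_assoc R.l_neg)
    ultimately have "comparable x y"
      unfolding comparable_def using i by (intro bexI[of _ "\<one> \<ominus> i"] bexI[of _ i]) auto
    then show False using not_comp by blast
  qed
  ultimately have "?L \<subset> ?Y" using xY by blast
  then obtain N where cov: "covers ?Y N" and LN: "?L \<subseteq> N"
    using covers_exists[OF fin Y L] by metis
  note N = coversD(2)[OF cov]
  have cyN: "cyclic y \<subseteq> N" using LN submodule_sum_upper(2)[OF Ix cy] by blast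
  have "x \<notin> N"
  proof
    assume "x \<in> N"
    then have "?Y \<subseteq> N" using cyclic_least[OF N] cyN by (intro submodule_sum_least[OF N])
    then show False using coversD(3)[OF cov] by blast
  qed
  define P where "P = {r \<in> carrier R. r \<odot>\<^bsub>M\<^esub> x \<in> N}"
  have maxP: "maximal_left_ideal P R"
    unfolding P_def using cov xY \<open>x \<notin> N\<close> by (intro covers_transporter_maximal) auto
  then have P: "left_ideal P R" by (simp add: maximal_left_ideal_def)
  have Px: "r \<in> P" if "r \<in> carrier R" "r \<odot>\<^bsub>M\<^esub> x \<in> cyclic y" for r
    using that cyN by (auto simp: P_def)
  have Py: "r \<in> P" if "r \<in> carrier R" "r \<odot>\<^bsub>M\<^esub> y \<in> cyclic x" for r
  proof -
    have "r \<odot>\<^bsub>M\<^esub> x \<in> Ix" using that by (auto simp: Ix_def I_def)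
    then show ?thesis using that LN submodule_sum_upper(1)[OF Ix cy] by (auto simp: P_def)
  qed
  have "finite (graph_submodule P x y ` R.idealizer P)"
    using submodule_graph[OF P x y]
    by (intro finite_subset[OF _ fin]) (auto simp: R.idealizer_def)
  then have "finite ((\<lambda>a. P +> a) ` R.idealizer P)"
  proof (rule finite_image_refine)
    fix a b assume ab: "a \<in> R.idealizer P" "b \<in> R.idealizer P"
      and eq: "graph_submodule P x y a = graph_submodule P x y b"
    have car: "a \<in> carrier R" "b \<in> carrier R" using ab by (auto simp: R.idealizer_def)
    have "a \<ominus> b \<in> P" by (rule graph_submodule_inj[OF P x y Px Py car(1) ab(2) eq])
    then show "P +> a = P +> b"
      using R.coset_eq_iff[OF R.left_ideal_additive_subgroup[OF P] car] by simp
  qed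
  then show ?thesis using that maxP Px Py by blast
qed

end

section \<open>Simple quotients of the ring and their endomorphisms\<close>

context ring
begin

text \<open>\<open>S\<close> is \<open>R / P\<close> carried by chosen coset representatives, hence
  by elements of the ring itself. An endomorphism is determined by its value at the class of
  \<open>1\<close>, which lies in the idealizer of \<open>P\<close>, so finitely many cosets allow
  finitely many endomorphisms.\<close>

lemma maximal_left_ideal_simple_quotient:
  assumes maxP: "maximal_left_ideal P R" and fin: "finite ((\<lambda>a. P +> a) ` idealizer P)"
  obtains S :: "('a, 'a) module"
  where "left_module R S" "simple_module R S" "finite (carrier (endo_ring R S))"
proof -
  have P: "left_ideal P R" using maxP by (simp add: maximal_left_ideal_def)
  note sg = left_ideal_additive_subgroup[OF P]
  interpret abelian_subgroup P R
    using sg abelian_group_axioms by (intro abelian_subgroupI3)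
  \<comment> \<open>The choice depends on \<open>a\<close> only through its coset, so equal cosets
    receive the same representative.\<close>
  define \<rho> where "\<rho> a = (SOME b. b \<in> P +> a)" for a
  have \<rho>_in: "\<rho> a \<in> P +> a" if "a \<in> carrier R" for a
    unfolding \<rho>_def using a_rcos_self[OF that] by (rule someI)
  have \<rho>_closed [simp]: "\<rho> a \<in> carrier R" if "a \<in> carrier R" for a
    using \<rho>_in[OF that] that a_subset by (auto simp: a_r_coset_def')
  have \<rho>_diff: "\<rho> a \<ominus> a \<in> P" if "a \<in> carrier R" for a
    using a_rcos_module_minus[OF ring_axioms that \<rho>_closed[OF that]] \<rho>_in[OF that] by simp
  have \<rho>_eqI: "\<rho> a = \<rho> b" if "a \<in> carrier R" "b \<in> carrier R" "a \<ominus> b \<in> P" for a b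
    using that coset_eq_iff[OF sg that(1,2)] by (simp add: \<rho>_def)
  have \<rho>_eqD: "a \<ominus> b \<in> P" if ab: "a \<in> carrier R" "b \<in> carrier R" and eq: "\<rho> a = \<rho> b" for a b
  proof -
    have "(\<rho> b \<ominus> b) \<ominus> (\<rho> a \<ominus> a) \<in> P" by (intro left_ideal_diff[OF P] \<rho>_diff ab)
    moreover have "(\<rho> b \<ominus> b) \<ominus> (\<rho> b \<ominus> a) = a \<ominus> b"
      using ab \<rho>_closed[OF ab(2)] by algebra
    ultimately show ?thesis by (simp add: eq)
  qed
  have \<rho>_idem [simp]: "\<rho> (\<rho> a) = \<rho> a" if "a \<in> carrier R" for a
    using that \<rho>_diff by (intro \<rho>_eqI) auto
  have \<rho>_add1 [simp]: "\<rho> (\<rho> a \<oplus> b) = \<rho> (a \<oplus> b)" if "a \<in> carrier R" "b \<in> carrier R" for a b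
  proof (rule \<rho>_eqI)
    have "(\<rho> a \<oplus> b) \<ominus> (a \<oplus> b) = \<rho> a \<ominus> a" using that \<rho>_closed[OF that(1)] by algebra
    then show "(\<rho> a \<oplus> b) \<ominus> (a \<oplus> b) \<in> P" using \<rho>_diff that by simp
  qed (use that in auto)
  have \<rho>_add2 [simp]: "\<rho> (a \<oplus> \<rho> b) = \<rho> (a \<oplus> b)" if "a \<in> carrier R" "b \<in> carrier R" for a b
    using \<rho>_add1[OF that(2,1)] that by (simp add: a_comm)
  \<comment> \<open>Nested forms, for the rewriting that verifies the group laws of
    \<open>S\<close>.\<close>
  have \<rho>_add3 [simp]: "\<rho> (a \<oplus> (\<rho> b \<oplus> c)) = \<rho> (a \<oplus> (b \<oplus> c))"
      "\<rho> (a \<oplus> (b \<oplus> \<rho> c)) = \<rho> (a \<oplus> (b \<oplus> c))"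
    if "a \<in> carrier R" "b \<in> carrier R" "c \<in> carrier R" for a b c
    using \<rho>_add2[OF that(1), of "\<rho> b \<oplus> c"] \<rho>_add2[OF that(1), of "b \<oplus> \<rho> c"]
      \<rho>_add2[OF that(1), of "b \<oplus> c"] that by simp_all
  have \<rho>_mult [simp]: "\<rho> (a \<otimes> \<rho> b) = \<rho> (a \<otimes> b)" if "a \<in> carrier R" "b \<in> carrier R" for a b
  proof (rule \<rho>_eqI)
    have "a \<otimes> \<rho> b \<ominus> a \<otimes> b = a \<otimes> (\<rho> b \<ominus> b)" using that \<rho>_closed[OF that(2)] by algebra
    then show "a \<otimes> \<rho> b \<ominus> a \<otimes> b \<in> P" using left_idealD(3)[OF P] \<rho>_diff that by simp
  qed (use that in auto)
  define S :: "('a, 'a) module" where "S =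
    \<lparr>carrier = \<rho> ` carrier R, mult = (\<lambda>a b. a), one = \<zero>, zero = \<rho> \<zero>,
     add = (\<lambda>a b. \<rho> (a \<oplus> b)), smult = (\<lambda>r a. \<rho> (r \<otimes> a))\<rparr>"
  have S [simp]: "carrier S = \<rho> ` carrier R" "\<zero>\<^bsub>S\<^esub> = \<rho> \<zero>" "a \<oplus>\<^bsub>S\<^esub> b = \<rho> (a \<oplus> b)"
    "r \<odot>\<^bsub>S\<^esub> a = \<rho> (r \<otimes> a)" for a b r
    by (simp_all add: S_def)
  have "abelian_group S"
  proof (rule abelian_groupI)
    fix a assume "a \<in> carrier S"
    then obtain r where "r \<in> carrier R" "a = \<rho> r" by auto
    then show "\<exists>b\<in>carrier S. b \<oplus>\<^bsub>S\<^esub> a = \<zero>\<^bsub>S\<^esub>"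
      by (intro bexI[of _ "\<rho> (\<ominus> r)"]) (auto simp: l_neg)
  qed (auto simp: a_ac)
  then have S_module: "left_module R S"
    by (intro left_module.intro left_module_axioms.intro ring_axioms)
       (auto simp: l_distr[symmetric] r_distr m_assoc[symmetric])
  interpret S: left_module R S by (fact S_module)
  have one_notin: "\<one> \<notin> P"
  proof
    assume "\<one> \<in> P"
    then have "a \<in> P" if "a \<in> carrier R" for a
      using left_idealD(3)[OF P that] that by (metis r_one)
    then show False using maxP left_idealD(4)[OF P] unfolding maximal_left_ideal_def by blast
  qed
  have S_simple: "simple_module R S"
    unfolding simple_module_def
  proof (intro conjI allI impI)
    have "\<rho> \<one> \<noteq> \<rho> \<zero>" using \<rho>_eqD[of \<one> \<zero>] one_notin by (auto simp: minus_eq)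
    then show "carrier S \<noteq> {\<zero>\<^bsub>S\<^esub>}" by auto
  next
    fix N assume N: "submodule N R S"
    note D = S.submoduleD[OF N, simplified]
    \<comment> \<open>The preimage of \<open>N\<close> in \<open>R\<close> lies above
      \<open>P\<close>, so maximality of \<open>P\<close> leaves two possibilities for it, and
      \<open>N\<close> is its image.\<close>
    let ?K = "{r \<in> carrier R. \<rho> r \<in> N}"
    have "left_ideal ?K R"
    proof (rule left_idealI)
      show "r \<oplus> s \<in> ?K" if "r \<in> ?K" "s \<in> ?K" for r s
        using D(2)[of "\<rho> r" "\<rho> s"] that by simp
      show "r \<otimes> s \<in> ?K" if "r \<in> carrier R" "s \<in> ?K" for r s
        using D(3)[of r "\<rho> s"] that by simp
    qed (use D in auto)
    moreover have "P \<subseteq> ?K"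
    proof
      fix p assume "p \<in> P"
      then have "p \<in> carrier R" "\<rho> p = \<rho> \<zero>"
        using left_idealD(4)[OF P] by (auto intro!: \<rho>_eqI simp: minus_eq)
      then show "p \<in> ?K" using D(1) by simp
    qed
    ultimately have "?K = P \<or> ?K = carrier R"
      using maxP unfolding maximal_left_ideal_def by blast
    moreover have N_eq: "N = \<rho> ` ?K"
    proof
      show "N \<subseteq> \<rho> ` ?K"
        using D(4) \<rho>_idem by fastforce
    qed auto
    moreover have "\<rho> ` P = {\<zero>\<^bsub>S\<^esub>}"
    proof -
      have "\<rho> p = \<rho> \<zero>" if "p \<in> P" for p
        using that left_idealD(4)[OF P that] by (intro \<rho>_eqI) (simp_all add: minus_eq)
      then show ?thesis unfolding S(2) using left_idealD(1)[OF P] by blast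
    qed
    ultimately show "N = {\<zero>\<^bsub>S\<^esub>} \<or> N = carrier S" by (metis S(1))
  qed
  let ?E = "carrier (endo_ring R S)" and ?ev = "\<lambda>f. f (\<rho> \<one>)"
  have endo: "f (\<rho> r) \<in> carrier R" "\<rho> (f (\<rho> r)) = f (\<rho> r)" "f (\<rho> r) = \<rho> (r \<otimes> f (\<rho> \<one>))"
    if f: "f \<in> ?E" and r: "r \<in> carrier R" for f r
  proof -
    have "f (\<rho> r) \<in> \<rho> ` carrier R"
      using f r by (auto simp: endo_ring_def PiE_iff)
    then obtain s where "s \<in> carrier R" "f (\<rho> r) = \<rho> s" by auto
    then show "f (\<rho> r) \<in> carrier R" "\<rho> (f (\<rho> r)) = f (\<rho> r)" by simp_all
    have "\<forall>a\<in>carrier R. \<forall>x\<in>carrier S. f (a \<odot>\<^bsub>S\<^esub> x) = a \<odot>\<^bsub>S\<^esub> f x"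
      using f by (simp add: endo_ring_def del: S)
    then have "f (r \<odot>\<^bsub>S\<^esub> \<rho> \<one>) = r \<odot>\<^bsub>S\<^esub> f (\<rho> \<one>)" using r by (metis S(1) imageI one_closed)
    then show "f (\<rho> r) = \<rho> (r \<otimes> f (\<rho> \<one>))" using r by simp
  qed
  \<comment> \<open>The class of \<open>p\<close> is zero, so its image under \<open>f\<close>, the
    class of \<open>p f(1)\<close>, is zero as well.\<close>
  have "?ev ` ?E \<subseteq> idealizer P"
  proof
    fix a assume "a \<in> ?ev ` ?E"
    then obtain f where f: "f \<in> ?E" "a = f (\<rho> \<one>)" by auto
    have a: "a \<in> carrier R" using endo(1)[OF f(1), of \<one>] f(2) by simp
    have "p \<otimes> a \<in> P" if "p \<in> P" for p
    proof -
      have p: "p \<in> carrier R" using left_idealD(4)[OF P that] .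
      have "\<rho> p = \<rho> \<zero>" using p that by (auto intro!: \<rho>_eqI simp: minus_eq)
      then have "\<rho> (p \<otimes> a) = \<rho> (\<zero> \<otimes> a)" using endo(3)[OF f(1) p] endo(3)[OF f(1) left_idealD(4)[OF P left_idealD(1)[OF P]]]
        unfolding f(2) by (simp only:)
      then show ?thesis using \<rho>_eqD[of "p \<otimes> a" \<zero>] a p by (simp add: minus_eq)
    qed
    then show "a \<in> idealizer P" using a by (simp add: idealizer_def)
  qed
  then have "finite ((\<lambda>a. P +> a) ` ?ev ` ?E)" by (intro finite_subset[OF image_mono fin])
  then have "finite ((\<lambda>f. P +> ?ev f) ` ?E)" by (simp add: image_image)
  \<comment> \<open>Conversely \<open>f\<close> is recovered from the coset of \<open>f(1)\<close>:
    the value \<open>f(1)\<close> is itself a representative, and \<open>f\<close> sends the class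
    of \<open>r\<close> to that of \<open>r f(1)\<close>.\<close>
  then have "finite ((\<lambda>f. f) ` ?E)"
  proof (rule finite_image_refine)
    fix f g assume f: "f \<in> ?E" and g: "g \<in> ?E" and "P +> ?ev f = P +> ?ev g"
    then have "\<rho> (?ev f) = \<rho> (?ev g)" by (simp add: \<rho>_def)
    then have ev: "f (\<rho> \<one>) = g (\<rho> \<one>)" using endo(2)[OF f, of \<one>] endo(2)[OF g, of \<one>] by simp
    have fg: "f \<in> carrier S \<rightarrow>\<^sub>E carrier S" "g \<in> carrier S \<rightarrow>\<^sub>E carrier S"
      using f g by (simp_all add: endo_ring_def)
    show "f = g"
    proof (rule PiE_ext[OF fg])
      fix z assume "z \<in> carrier S"
      then obtain r where r: "r \<in> carrier R" and z: "z = \<rho> r" by auto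
      then show "f z = g z" using endo(3)[OF f r] endo(3)[OF g r] ev by (simp only: z)
    qed
  qed
  then show ?thesis using S_module S_simple by (intro that[of S]) auto
qed

end

text \<open>A pair that is not comparable would give a simple module with finite endomorphism ring.
  Its carrier lies in \<open>'r\<close>, whereas \<open>inf\<close> concerns carriers in
  \<open>'r set\<close>; \<open>simple_modules_on_coset_type_suffice\<close> bridges the two
  types.\<close>

theorem distributive_if_infinite_endomorphisms:
  fixes R :: "('r, 'e) ring_scheme" and M :: "('r, 'm, 'x) module_scheme"
  assumes inf: "\<And>S :: ('r, 'r set) module.
      left_module R S \<Longrightarrow> simple_module R S \<Longrightarrow> infinite (carrier (endo_ring R S))"
    and M: "left_module R M" and fin: "finite {N. submodule N R M}"
  shows "distributive_module R M"
proof -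
  interpret left_module R M by fact
  have comp: "comparable x y" if "x \<in> carrier M" "y \<in> carrier M" for x y
  proof (rule ccontr)
    assume "\<not> comparable x y"
    from not_comparable_finite_idealizer[OF fin that this]
    obtain P where P: "maximal_left_ideal P R" "finite ((\<lambda>a. P +>\<^bsub>R\<^esub> a) ` R.idealizer P)"
      by metis
    from R.maximal_left_ideal_simple_quotient[OF P]
    obtain S :: "('r, 'r) module" where
      S: "left_module R S" "simple_module R S" "finite (carrier (endo_ring R S))" by blast
    then show False using simple_modules_on_coset_type_suffice[OF inf S(1,2)] by blast
  qed
  show ?thesis
    unfolding distributive_module_def
  proof (intro allI impI)
    fix A B C assume "submodule A R M" "submodule B R M" "submodule C R M"
    then show "A \<inter> (B <+>\<^bsub>M\<^esub> C) = (A \<inter> B) <+>\<^bsub>M\<^esub> (A \<inter> C)"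
      by (rule inter_sum_distrib) (use comp submoduleD(4) \<open>submodule B R M\<close> \<open>submodule C R M\<close> in blast)
  qed
qed

section \<open>The finite part of a semisimple ring\<close>

context ring
begin

lemma diff_eq_zero_iff [simp]:
  assumes "a \<in> carrier R" "b \<in> carrier R"
  shows "a \<ominus> b = \<zero> \<longleftrightarrow> a = b"
proof
  assume "a \<ominus> b = \<zero>"
  then have "(a \<ominus> b) \<oplus> b = b" using assms by simp
  then show "a = b" using assms by (simp add: minus_eq a_assoc l_neg)
qed (use assms in \<open>simp add: minus_eq r_neg\<close>)

lemma idealI':
  assumes "\<And>x. x \<in> I \<Longrightarrow> x \<in> carrier R" "\<zero> \<in> I"
    "\<And>x y. x \<in> I \<Longrightarrow> y \<in> I \<Longrightarrow> x \<oplus> y \<in> I"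
    "\<And>a x. a \<in> carrier R \<Longrightarrow> x \<in> I \<Longrightarrow> a \<otimes> x \<in> I"
    "\<And>a x. a \<in> carrier R \<Longrightarrow> x \<in> I \<Longrightarrow> x \<otimes> a \<in> I"
  shows "ideal I R"
  using assms left_idealI[of I] by (auto simp: ideal_iff)

text \<open>Split \<open>1 = g + d\<close> along a decomposition of \<open>R\<close> into
  \<open>I\<close> and a complement \<open>B\<close>. For \<open>x\<close> in \<open>I\<close>, the
  element \<open>x d = x - x g\<close> lies in both summands, so it is zero.\<close>

lemma semisimple_left_ideal_right_unit:
  assumes ss: "semisimple_ring R" and I: "left_ideal I R"
  shows "\<exists>g\<in>I. \<forall>x\<in>I. x \<otimes> g = x"
proof -
  obtain B where "internal_direct_sum R (regular_module R) I B"
    using ss I unfolding semisimple_ring_def semisimple_module_def left_ideal_def by blast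
  then have B: "left_ideal B R" and sum: "I <+>\<^bsub>regular_module R\<^esub> B = carrier R"
    and int: "I \<inter> B = {\<zero>}"
    by (auto simp: internal_direct_sum_def left_ideal_def regular_module_def)
  have "\<one> \<in> I <+>\<^bsub>regular_module R\<^esub> B" unfolding sum by simp
  then obtain g d where gd: "g \<in> I" "d \<in> B" "\<one> = g \<oplus> d"
    by (auto simp: set_add_def' regular_module_def)
  have car: "g \<in> carrier R" "d \<in> carrier R"
    using gd left_idealD(4)[OF I] left_idealD(4)[OF B] by auto
  have "x \<otimes> g = x" if x: "x \<in> I" for x
  proof -
    have xR: "x \<in> carrier R" using left_idealD(4)[OF I x] .
    have eq: "x = x \<otimes> g \<oplus> x \<otimes> d"
      using gd(3) car xR by (metis r_distr r_one)
    then have "x \<otimes> d = x \<ominus> x \<otimes> g"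
      using car xR by (metis a_comm minus_eq add.inv_solve_right m_closed)
    moreover have "x \<ominus> x \<otimes> g \<in> I"
      using left_ideal_diff[OF I x left_idealD(3)[OF I xR gd(1)]] .
    moreover have "x \<otimes> d \<in> B" using left_idealD(3)[OF B xR gd(2)] .
    ultimately have "x \<otimes> d = \<zero>" using int by auto
    then show ?thesis using eq car xR by simp
  qed
  then show ?thesis using gd(1) by blast
qed

text \<open>A right unit \<open>c\<close> of \<open>I\<close> satisfies \<open>c a c = c a\<close>
  because \<open>c a\<close> lies in \<open>I\<close>. Also \<open>a c = c a c\<close>, because the
  difference lies in the part of \<open>I\<close> killed by \<open>c\<close> on the left; that part
  has a right unit of its own and is shown to vanish.\<close>

lemma semisimple_ideal_unit:
  assumes ss: "semisimple_ring R" and I: "ideal I R"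
  shows "\<exists>c\<in>I. (\<forall>x\<in>I. x \<otimes> c = x) \<and> (\<forall>a\<in>carrier R. a \<otimes> c = c \<otimes> a)"
proof -
  have lI: "left_ideal I R" and rI: "\<And>x a. x \<in> I \<Longrightarrow> a \<in> carrier R \<Longrightarrow> x \<otimes> a \<in> I"
    using I by (auto simp: ideal_iff)
  note D = left_idealD[OF lI]
  obtain c where c: "c \<in> I" "\<And>x. x \<in> I \<Longrightarrow> x \<otimes> c = x"
    using semisimple_left_ideal_right_unit[OF ss lI] by blast
  have cR: "c \<in> carrier R" using D(4)[OF c(1)] .
  have cac: "c \<otimes> a \<otimes> c = c \<otimes> a" if "a \<in> carrier R" for a
    using c(2)[OF rI[OF c(1) that]] .
  define N where "N = {x \<in> I. c \<otimes> x = \<zero>}"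
  have lN: "left_ideal N R"
  proof (rule left_idealI)
    fix a x assume a: "a \<in> carrier R" and "x \<in> N"
    then have x: "x \<in> I" "c \<otimes> x = \<zero>" by (auto simp: N_def)
    have xR: "x \<in> carrier R" using D(4)[OF x(1)] .
    have "c \<otimes> (a \<otimes> x) = c \<otimes> a \<otimes> c \<otimes> x" using cac[OF a] a xR cR by (simp add: m_assoc)
    also have "\<dots> = \<zero>" using x a xR cR by (simp add: m_assoc)
    finally show "a \<otimes> x \<in> N" using D(3)[OF a x(1)] by (simp add: N_def)
  qed (use D cR in \<open>auto simp: N_def r_distr\<close>)
  obtain g where g: "g \<in> N" "\<And>x. x \<in> N \<Longrightarrow> x \<otimes> g = x"
    using semisimple_left_ideal_right_unit[OF ss lN] by blast
  have gI: "g \<in> I" "c \<otimes> g = \<zero>" using g(1) by (auto simp: N_def)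
  have gR: "g \<in> carrier R" using D(4)[OF gI(1)] .
  \<comment> \<open>The right unit \<open>g\<close> of \<open>N\<close> is idempotent and satisfies
    \<open>g c = g\<close> as an element of \<open>I\<close>, while \<open>c g = 0\<close>; so
    \<open>g = g c g = 0\<close>.\<close>
  have "g = g \<otimes> c \<otimes> g" using g(2)[OF g(1)] c(2)[OF gI(1)] by simp
  then have "g = \<zero>" using gI gR cR by (simp add: m_assoc)
  then have N0: "x = \<zero>" if "x \<in> N" for x
    using g(2)[OF that] D(4) that by (auto simp: N_def)
  have "a \<otimes> c = c \<otimes> a" if a: "a \<in> carrier R" for a
  proof -
    have ac: "a \<otimes> c \<in> I" "c \<otimes> (a \<otimes> c) \<in> I" using D(3) a c(1) cR by auto
    have cc: "c \<otimes> c = c" using c by simp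
    have "c \<otimes> (a \<otimes> c \<ominus> c \<otimes> (a \<otimes> c)) = c \<otimes> (a \<otimes> c) \<ominus> (c \<otimes> c) \<otimes> (a \<otimes> c)"
      using a cR by algebra
    also have "\<dots> = \<zero>" unfolding cc using a cR by (simp add: minus_eq r_neg)
    finally have "a \<otimes> c \<ominus> c \<otimes> (a \<otimes> c) \<in> N"
      using left_ideal_diff[OF lI ac] by (simp add: N_def)
    then have "a \<otimes> c \<ominus> c \<otimes> (a \<otimes> c) = \<zero>" by (rule N0)
    then have "a \<otimes> c = c \<otimes> (a \<otimes> c)" using a cR by simp
    also have "\<dots> = c \<otimes> a" using cac[OF a] a cR by (simp add: m_assoc)
    finally show ?thesis .
  qed
  then show ?thesis using c by blast
qed

text \<open>Multiplying \<open>t\<close> on the left shrinks \<open>R t\<close>, and multiplying it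
  by \<open>b\<close> on the right maps \<open>R t\<close> onto \<open>R t b\<close>. In a
  semisimple ring this ideal is the largest finite one.\<close>

lemma ideal_finite_principal:
  "ideal {t \<in> carrier R. finite ((\<lambda>a. a \<otimes> t) ` carrier R)} R" (is "ideal ?F R")
proof (rule idealI')
  fix t u assume tu: "t \<in> ?F" "u \<in> ?F"
  have "(\<lambda>a. a \<otimes> (t \<oplus> u)) ` carrier R
      \<subseteq> (\<lambda>(x, y). x \<oplus> y) ` ((\<lambda>a. a \<otimes> t) ` carrier R \<times> (\<lambda>a. a \<otimes> u) ` carrier R)"
    using tu by (auto simp: r_distr)
  then have "finite ((\<lambda>a. a \<otimes> (t \<oplus> u)) ` carrier R)"
    by (rule finite_subset) (use tu in simp)
  then show "t \<oplus> u \<in> ?F" using tu by simp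
next
  fix b t assume bt: "b \<in> carrier R" "t \<in> ?F"
  have "(\<lambda>a. a \<otimes> (b \<otimes> t)) ` carrier R \<subseteq> (\<lambda>a. a \<otimes> t) ` carrier R"
    using bt by (auto simp: m_assoc[symmetric])
  then have "finite ((\<lambda>a. a \<otimes> (b \<otimes> t)) ` carrier R)"
    by (rule finite_subset) (use bt in simp)
  then show "b \<otimes> t \<in> ?F" using bt by simp
  have "(\<lambda>a. a \<otimes> (t \<otimes> b)) ` carrier R \<subseteq> (\<lambda>x. x \<otimes> b) ` (\<lambda>a. a \<otimes> t) ` carrier R"
    using bt by (auto simp: m_assoc[symmetric])
  then have "finite ((\<lambda>a. a \<otimes> (t \<otimes> b)) ` carrier R)"
    by (rule finite_subset) (use bt in simp)
  then show "t \<otimes> b \<in> ?F" using bt by simp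
qed (auto simp: image_constant_conv)

text \<open>Serves to pass from finiteness of \<open>g R g\<close> to finiteness of
  \<open>R g\<close>: over a semisimple ring this ideal has a central unit, which can be moved
  across.\<close>

lemma ideal_finite_sandwich:
  assumes g: "g \<in> carrier R"
  shows "ideal {t \<in> carrier R. finite ((\<lambda>a. t \<otimes> a \<otimes> g) ` carrier R)} R" (is "ideal ?F R")
proof (rule idealI')
  fix t u assume tu: "t \<in> ?F" "u \<in> ?F"
  have "(\<lambda>a. (t \<oplus> u) \<otimes> a \<otimes> g) ` carrier R
      \<subseteq> (\<lambda>(x, y). x \<oplus> y) ` ((\<lambda>a. t \<otimes> a \<otimes> g) ` carrier R \<times> (\<lambda>a. u \<otimes> a \<otimes> g) ` carrier R)"
    using tu g by (auto simp: l_distr)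
  then have "finite ((\<lambda>a. (t \<oplus> u) \<otimes> a \<otimes> g) ` carrier R)"
    by (rule finite_subset) (use tu in simp)
  then show "t \<oplus> u \<in> ?F" using tu by simp
next
  fix b t assume bt: "b \<in> carrier R" "t \<in> ?F"
  have "(\<lambda>a. b \<otimes> t \<otimes> a \<otimes> g) ` carrier R \<subseteq> (\<lambda>x. b \<otimes> x) ` (\<lambda>a. t \<otimes> a \<otimes> g) ` carrier R"
    using bt g by (auto simp: m_assoc)
  then have "finite ((\<lambda>a. b \<otimes> t \<otimes> a \<otimes> g) ` carrier R)"
    by (rule finite_subset) (use bt in simp)
  then show "b \<otimes> t \<in> ?F" using bt by simp
  have "(\<lambda>a. t \<otimes> b \<otimes> a \<otimes> g) ` carrier R \<subseteq> (\<lambda>a. t \<otimes> a \<otimes> g) ` carrier R"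
  proof (rule image_subsetI)
    fix a assume "a \<in> carrier R"
    then show "t \<otimes> b \<otimes> a \<otimes> g \<in> (\<lambda>a. t \<otimes> a \<otimes> g) ` carrier R"
      using bt g by (intro image_eqI[of _ _ "b \<otimes> a"]) (auto simp: m_assoc)
  qed
  then have "finite ((\<lambda>a. t \<otimes> b \<otimes> a \<otimes> g) ` carrier R)"
    by (rule finite_subset) (use bt in simp)
  then show "t \<otimes> b \<in> ?F" using bt by simp
qed (use g in \<open>auto simp: image_constant_conv\<close>)

text \<open>\<open>c\<close> is the unit of the largest finite ideal. An idempotent with finite
  corner lies in that ideal, and an ideal of finite index contains \<open>1 - c\<close> because it
  has a finite complement.\<close>

lemma semisimple_finite_part:
  assumes ss: "semisimple_ring R"
  obtains c where "c \<in> carrier R" "c \<otimes> c = c" "\<And>a. a \<in> carrier R \<Longrightarrow> a \<otimes> c = c \<otimes> a"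
    "finite ((\<lambda>a. a \<otimes> c) ` carrier R)"
    "\<And>g. \<lbrakk>g \<in> carrier R; g \<otimes> g = g; finite ((\<lambda>a. g \<otimes> a \<otimes> g) ` carrier R)\<rbrakk> \<Longrightarrow> g \<otimes> c = g"
    "\<And>B. \<lbrakk>ideal B R; finite ((\<lambda>a. B +> a) ` carrier R)\<rbrakk> \<Longrightarrow> \<one> \<ominus> c \<in> B"
proof -
  obtain c where cF: "c \<in> {t \<in> carrier R. finite ((\<lambda>a. a \<otimes> t) ` carrier R)}"
    and unit': "\<And>t. t \<in> {t \<in> carrier R. finite ((\<lambda>a. a \<otimes> t) ` carrier R)} \<Longrightarrow> t \<otimes> c = t"
    and central: "\<And>a. a \<in> carrier R \<Longrightarrow> a \<otimes> c = c \<otimes> a"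
    using semisimple_ideal_unit[OF ss ideal_finite_principal] by blast
  have c: "c \<in> carrier R" "finite ((\<lambda>a. a \<otimes> c) ` carrier R)" using cF by auto
  have unit: "t \<otimes> c = t" if "t \<in> carrier R" "finite ((\<lambda>a. a \<otimes> t) ` carrier R)" for t
    using unit' that by blast
  have corner: "g \<otimes> c = g" if g: "g \<in> carrier R" "g \<otimes> g = g"
    and fin: "finite ((\<lambda>a. g \<otimes> a \<otimes> g) ` carrier R)" for g
  proof -
    let ?Q = "{t \<in> carrier R. finite ((\<lambda>a. t \<otimes> a \<otimes> g) ` carrier R)}"
    obtain b where b: "b \<in> ?Q" "\<And>x. x \<in> ?Q \<Longrightarrow> x \<otimes> b = x"
        "\<And>a. a \<in> carrier R \<Longrightarrow> a \<otimes> b = b \<otimes> a"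
      using semisimple_ideal_unit[OF ss ideal_finite_sandwich[OF g(1)]] by blast
    have bR: "b \<in> carrier R" using b(1) by simp
    have gb: "g \<otimes> b = g" using b(2) g fin by blast
    \<comment> \<open>Since \<open>g\<close> itself lies in \<open>?Q\<close>,
      \<open>g b = g\<close>; as \<open>b\<close> is central, \<open>a g = a g b = b a g\<close>,
      and \<open>R g\<close> equals the finite set \<open>b R g\<close>.\<close>
    have "a \<otimes> g = b \<otimes> a \<otimes> g" if a: "a \<in> carrier R" for a
    proof -
      have "a \<otimes> g = (a \<otimes> g) \<otimes> b" using gb a g(1) bR by (simp add: m_assoc)
      also have "\<dots> = b \<otimes> (a \<otimes> g)" using b(3) a g(1) by simp
      finally show ?thesis using a g(1) bR by (simp add: m_assoc)
    qed
    then have "(\<lambda>a. a \<otimes> g) ` carrier R = (\<lambda>a. b \<otimes> a \<otimes> g) ` carrier R"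
      by (intro image_cong) auto
    then show ?thesis using unit g(1) b(1) by simp
  qed
  have index: "\<one> \<ominus> c \<in> B"
    if B: "ideal B R" and fin: "finite ((\<lambda>a. B +> a) ` carrier R)" for B
  proof -
    have lB: "left_ideal B R" and rB: "\<And>x a. x \<in> B \<Longrightarrow> a \<in> carrier R \<Longrightarrow> x \<otimes> a \<in> B"
      using B by (auto simp: ideal_iff)
    obtain b where b: "b \<in> B" "\<And>x. x \<in> B \<Longrightarrow> x \<otimes> b = x"
      using semisimple_left_ideal_right_unit[OF ss lB] by blast
    have bR: "b \<in> carrier R" using left_idealD(4)[OF lB b(1)] .
    \<comment> \<open>Right multiplication by \<open>1 - b\<close> kills \<open>B\<close>, so it
      factors through the finite quotient by \<open>B\<close>.\<close>
    have "finite ((\<lambda>a. a \<otimes> (\<one> \<ominus> b)) ` carrier R)"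
    proof (rule finite_image_refine[OF fin])
      fix x y assume xy: "x \<in> carrier R" "y \<in> carrier R" and "B +> x = B +> y"
      then have "x \<ominus> y \<in> B" using coset_eq_iff[OF left_ideal_additive_subgroup[OF lB]] by simp
      then have *: "(x \<ominus> y) \<otimes> b = x \<ominus> y" by (rule b(2))
      have "x \<otimes> (\<one> \<ominus> b) \<ominus> y \<otimes> (\<one> \<ominus> b) = (x \<ominus> y) \<ominus> (x \<ominus> y) \<otimes> b"
        using xy bR
        by (simp add: minus_eq l_distr r_distr l_minus r_minus minus_add a_ac)
      also have "\<dots> = \<zero>" unfolding * using xy by (simp add: minus_eq r_neg)
      finally show "x \<otimes> (\<one> \<ominus> b) = y \<otimes> (\<one> \<ominus> b)" using xy bR by simp
    qed
    then have "(\<one> \<ominus> b) \<otimes> c = \<one> \<ominus> b" using unit bR by simp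
    then have *: "c \<ominus> b \<otimes> c = \<one> \<ominus> b"
      using bR c(1) by (simp add: minus_eq l_distr l_minus)
    \<comment> \<open>The last identity says \<open>(1 - b) (1 - c) = 0\<close>, that is,
      \<open>1 - c = b (1 - c)\<close>.\<close>
    have "\<one> \<ominus> c = b \<oplus> (\<one> \<ominus> b) \<ominus> c" using bR c(1) by algebra
    also have "\<dots> = b \<ominus> b \<otimes> c" unfolding *[symmetric] using bR c(1) by algebra
    also have "\<dots> = b \<otimes> (\<one> \<ominus> c)" using bR c(1) by (simp add: minus_eq r_distr r_minus)
    finally have eq: "\<one> \<ominus> c = b \<otimes> (\<one> \<ominus> c)" .
    show ?thesis by (subst eq) (rule rB[OF b(1)], simp add: c(1))
  qed
  show ?thesis by (rule that[OF c(1) unit[OF c] central c(2) corner index])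
qed

section \<open>Semiperfect rings\<close>

text \<open>\<open>e\<close> lifts the unit \<open>c\<close> of the largest finite ideal of
  \<open>R / J\<close>, and the properties of \<open>c\<close> are pulled back along the quotient
  map. The last conclusion rests on an idempotent \<open>g\<close> of \<open>R / J\<close> that
  annihilates the image of \<open>P\<close> from the right: its corner acts on \<open>R / P\<close>
  by endomorphisms, so it is finite, and \<open>g\<close> must vanish.\<close>

lemma coset_finite_part_lift:
  assumes J: "ideal J R" and ss: "semisimple_ring (R Quot J)"
    and lift: "idempotents_lift_modulo R J"
  obtains e where "e \<in> carrier R" "e \<otimes> e = e"
    "\<And>r. r \<in> carrier R \<Longrightarrow> e \<otimes> r \<ominus> r \<otimes> e \<in> J"
    "finite ((\<lambda>r. J +> r \<otimes> e) ` carrier R)"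
    "\<And>B. \<lbrakk>ideal B R; J \<subseteq> B; finite ((\<lambda>a. B +> a) ` carrier R)\<rbrakk> \<Longrightarrow> \<one> \<ominus> e \<in> B"
    "\<And>P. \<lbrakk>left_ideal P R; J \<subseteq> P; e \<in> P;
        finite ((\<lambda>a. P +> a) ` idealizer P)\<rbrakk> \<Longrightarrow> \<one> \<in> P"
proof -
  interpret J: ideal J R by fact
  let ?A = "R Quot J"
  interpret A: ring ?A by (rule J.quotient_is_ring)
  interpret \<pi>: ring_hom_ring R ?A "(+>) J" by (rule J.rcos_ring_hom_ring)
  have lJ: "left_ideal J R" using J by (simp add: ideal_iff)
  have \<pi>_eq: "J +> a = J +> b \<longleftrightarrow> a \<ominus> b \<in> J" if "a \<in> carrier R" "b \<in> carrier R" for a b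
    by (rule coset_eq_iff[OF J.additive_subgroup_axioms that])
  note \<pi>_eqD = \<pi>_eq[THEN iffD1]
  have \<pi>_diff: "J +> (a \<ominus> b) = (J +> a) \<ominus>\<^bsub>?A\<^esub> (J +> b)"
    if "a \<in> carrier R" "b \<in> carrier R" for a b
    using that by (simp add: minus_eq A.minus_eq)
  have \<pi>_zero: "J +> a = \<zero>\<^bsub>?A\<^esub> \<longleftrightarrow> a \<in> J" if "a \<in> carrier R" for a
    using \<pi>_eq[OF that zero_closed] that \<pi>.hom_zero by (simp add: minus_eq)
  have \<pi>_surj: "carrier ?A = (\<lambda>a. J +> a) ` carrier R"
    unfolding FactRing_def A_RCOSETS_def' partial_object.simps by blast
  have left_ideal_image: "left_ideal ((\<lambda>a. J +> a) ` P) ?A" if P: "left_ideal P R" for P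
  proof (rule A.left_idealI)
    note D = left_idealD[OF P]
    fix x assume x: "x \<in> (\<lambda>a. J +> a) ` P"
    then obtain p where p: "p \<in> P" "x = J +> p" by auto
    show "x \<in> carrier ?A" using p D(4) by simp
    show "a \<otimes>\<^bsub>?A\<^esub> x \<in> (\<lambda>a. J +> a) ` P" if a: "a \<in> carrier ?A" for a
    proof -
      obtain r where "r \<in> carrier R" "a = J +> r" using a unfolding \<pi>_surj by auto
      then show ?thesis
        using p D(3)[of r p] D(4) by (intro image_eqI[of _ _ "r \<otimes> p"]) auto
    qed
    show "x \<oplus>\<^bsub>?A\<^esub> y \<in> (\<lambda>a. J +> a) ` P" if y: "y \<in> (\<lambda>a. J +> a) ` P" for y
    proof -
      obtain q where "q \<in> P" "y = J +> q" using y by auto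
      then show ?thesis
        using p D(2)[of p q] D(4) by (intro image_eqI[of _ _ "p \<oplus> q"]) auto
    qed
  next
    show "\<zero>\<^bsub>?A\<^esub> \<in> (\<lambda>a. J +> a) ` P"
      using left_idealD(1)[OF P] \<pi>.hom_zero by (metis image_eqI)
  qed
  have image_mem: "a \<in> P"
    if P: "left_ideal P R" "J \<subseteq> P" and a: "a \<in> carrier R" "J +> a \<in> (\<lambda>a. J +> a) ` P" for P a
  proof -
    obtain p where p: "p \<in> P" "J +> a = J +> p" using a(2) by auto
    have pR: "p \<in> carrier R" using left_idealD(4)[OF P(1) p(1)] .
    have "a \<ominus> p \<in> P" using p(2) \<pi>_eq[OF a(1) pR] P(2) by blast
    then have "(a \<ominus> p) \<oplus> p \<in> P" using p(1) left_idealD(2)[OF P(1)] by blast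
    then show ?thesis using a(1) pR by (simp add: minus_eq a_assoc l_neg)
  qed
  show ?thesis
  proof (rule A.semisimple_finite_part[OF ss])
    fix c
    assume c: "c \<in> carrier ?A" "c \<otimes>\<^bsub>?A\<^esub> c = c"
    and central: "\<And>a. a \<in> carrier ?A \<Longrightarrow> a \<otimes>\<^bsub>?A\<^esub> c = c \<otimes>\<^bsub>?A\<^esub> a"
    and fin: "finite ((\<lambda>a. a \<otimes>\<^bsub>?A\<^esub> c) ` carrier ?A)"
    and corner: "\<And>g. \<lbrakk>g \<in> carrier ?A; g \<otimes>\<^bsub>?A\<^esub> g = g;
      finite ((\<lambda>a. g \<otimes>\<^bsub>?A\<^esub> a \<otimes>\<^bsub>?A\<^esub> g) ` carrier ?A)\<rbrakk> \<Longrightarrow> g \<otimes>\<^bsub>?A\<^esub> c = g"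
    and index: "\<And>B. \<lbrakk>ideal B ?A; finite ((\<lambda>a. B +>\<^bsub>?A\<^esub> a) ` carrier ?A)\<rbrakk>
      \<Longrightarrow> \<one>\<^bsub>?A\<^esub> \<ominus>\<^bsub>?A\<^esub> c \<in> B"
    obtain x where x: "x \<in> carrier R" "c = J +> x" using c(1) unfolding \<pi>_surj by auto
    have "J +> (x \<otimes> x) = J +> x" using c(2) x by simp
    then have "x \<otimes> x \<ominus> x \<in> J" by (rule \<pi>_eqD[rotated 2]) (use x in simp_all)
    then have "\<exists>e\<in>carrier R. e \<otimes> e = e \<and> e \<ominus> x \<in> J"
      using lift x(1) by (simp add: idempotents_lift_modulo_def)
    then obtain e where e: "e \<in> carrier R" "e \<otimes> e = e" "e \<ominus> x \<in> J" by blast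
    have ce: "c = J +> e" using \<pi>_eq[OF e(1) x(1)] e(3) x(2) by simp
    show ?thesis
    proof (rule that[OF e(1,2)])
      fix r assume r: "r \<in> carrier R"
      have "J +> (e \<otimes> r) = J +> (r \<otimes> e)" using central[of "J +> r"] r e(1) by (simp add: ce)
      then show "e \<otimes> r \<ominus> r \<otimes> e \<in> J" by (rule \<pi>_eqD[rotated 2]) (use r e(1) in simp_all)
    next
      have "(\<lambda>r. J +> r \<otimes> e) ` carrier R = (\<lambda>a. a \<otimes>\<^bsub>?A\<^esub> c) ` carrier ?A"
        unfolding \<pi>_surj image_image using e(1) by (intro image_cong) (auto simp: ce)
      then show "finite ((\<lambda>r. J +> r \<otimes> e) ` carrier R)" using fin by simp
    next
      fix B assume B: "ideal B R" "J \<subseteq> B" and finB: "finite ((\<lambda>a. B +> a) ` carrier R)"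
      let ?B = "(\<lambda>a. J +> a) ` B"
      have lB: "left_ideal B R" and rB: "\<And>x a. x \<in> B \<Longrightarrow> a \<in> carrier R \<Longrightarrow> x \<otimes> a \<in> B"
        using B by (auto simp: ideal_iff)
      have lB': "left_ideal ?B ?A" by (rule left_ideal_image[OF lB])
      have "b \<otimes>\<^bsub>?A\<^esub> a \<in> ?B" if ab: "b \<in> ?B" "a \<in> carrier ?A" for a b
      proof -
        obtain b' a' where "b' \<in> B" "b = J +> b'" "a' \<in> carrier R" "a = J +> a'"
          using ab unfolding \<pi>_surj by auto
        then show ?thesis
          using rB left_idealD(4)[OF lB] by (intro image_eqI[of _ _ "b' \<otimes> a'"]) auto
      qed
      then have "ideal ?B ?A" using lB' by (simp add: A.ideal_iff)
      moreover have "finite ((\<lambda>a. ?B +>\<^bsub>?A\<^esub> a) ` carrier ?A)"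
        unfolding \<pi>_surj image_image
      proof (rule finite_image_refine[OF finB])
        fix a b assume ab: "a \<in> carrier R" "b \<in> carrier R" and "B +> a = B +> b"
        then have "a \<ominus> b \<in> B" using coset_eq_iff[OF left_ideal_additive_subgroup[OF lB]] by simp
        then have "(J +> a) \<ominus>\<^bsub>?A\<^esub> (J +> b) \<in> ?B" using \<pi>_diff[OF ab] by (metis image_eqI)
        then show "?B +>\<^bsub>?A\<^esub> (J +> a) = ?B +>\<^bsub>?A\<^esub> (J +> b)"
          using A.coset_eq_iff[OF A.left_ideal_additive_subgroup[OF lB']] ab by simp
      qed
      ultimately have "\<one>\<^bsub>?A\<^esub> \<ominus>\<^bsub>?A\<^esub> c \<in> ?B" by (rule index)
      then have "J +> (\<one> \<ominus> e) \<in> ?B" using \<pi>_diff[OF one_closed e(1)] by (simp add: ce)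
      then show "\<one> \<ominus> e \<in> B" using image_mem[OF lB B(2)] e(1) by simp
    next
      fix P assume P: "left_ideal P R" "J \<subseteq> P" and eP: "e \<in> P"
        and finP: "finite ((\<lambda>a. P +> a) ` idealizer P)"
      let ?P = "(\<lambda>a. J +> a) ` P"
      note lP = left_ideal_image[OF P(1)]
      obtain h where h: "h \<in> ?P" and h_unit: "\<forall>u\<in>?P. u \<otimes>\<^bsub>?A\<^esub> h = u"
        using A.semisimple_left_ideal_right_unit[OF ss lP] by (rule bexE)
      have hA: "h \<in> carrier ?A" using A.left_idealD(4)[OF lP h] .
      define g where "g = \<one>\<^bsub>?A\<^esub> \<ominus>\<^bsub>?A\<^esub> h"
      have g: "g \<in> carrier ?A" using hA by (simp add: g_def)
      have Pg: "u \<otimes>\<^bsub>?A\<^esub> g = \<zero>\<^bsub>?A\<^esub>" if "u \<in> ?P" for u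
      proof -
        have u: "u \<in> carrier ?A" using A.left_idealD(4)[OF lP that] .
        then have "u \<otimes>\<^bsub>?A\<^esub> g = u \<ominus>\<^bsub>?A\<^esub> u \<otimes>\<^bsub>?A\<^esub> h"
          unfolding g_def using hA by (simp add: A.minus_eq A.r_distr A.r_minus)
        then show ?thesis using bspec[OF h_unit that] u by (simp add: A.minus_eq A.r_neg)
      qed
      have "g \<otimes>\<^bsub>?A\<^esub> g = g \<ominus>\<^bsub>?A\<^esub> h \<otimes>\<^bsub>?A\<^esub> g"
        using hA g by (simp add: g_def A.minus_eq A.l_distr A.l_minus)
      then have gg: "g \<otimes>\<^bsub>?A\<^esub> g = g" using Pg[OF h] g by (simp add: A.minus_eq)
      \<comment> \<open>\<open>G\<close> is the preimage in \<open>R\<close> of the corner of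
        \<open>g\<close>, needed because the idealizer lives in \<open>R\<close> and not in the
        quotient.\<close>
      define G where "G = {r \<in> carrier R. \<exists>a\<in>carrier ?A. J +> r = g \<otimes>\<^bsub>?A\<^esub> a \<otimes>\<^bsub>?A\<^esub> g}"
      have Gg: "(J +> r) \<otimes>\<^bsub>?A\<^esub> g = J +> r" if r: "r \<in> G" for r
      proof -
        obtain a where "a \<in> carrier ?A" "J +> r = g \<otimes>\<^bsub>?A\<^esub> a \<otimes>\<^bsub>?A\<^esub> g" using r by (auto simp: G_def)
        then show ?thesis using g gg by (simp add: A.m_assoc)
      qed
      have "G \<subseteq> idealizer P"
      proof
        fix r assume "r \<in> G"
        then obtain a where r: "r \<in> carrier R" and a: "a \<in> carrier ?A"
          and ra: "J +> r = g \<otimes>\<^bsub>?A\<^esub> a \<otimes>\<^bsub>?A\<^esub> g" by (auto simp: G_def)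
        have "p \<otimes> r \<in> P" if p: "p \<in> P" for p
        proof -
          have pR: "p \<in> carrier R" using left_idealD(4)[OF P(1) p] .
          have "J +> (p \<otimes> r) = ((J +> p) \<otimes>\<^bsub>?A\<^esub> g) \<otimes>\<^bsub>?A\<^esub> (a \<otimes>\<^bsub>?A\<^esub> g)"
            using pR r ra a g by (simp add: A.m_assoc)
          also have "\<dots> = \<zero>\<^bsub>?A\<^esub>" using Pg[of "J +> p"] p a g by simp
          finally show ?thesis using \<pi>_zero[of "p \<otimes> r"] pR r P(2) by auto
        qed
        then show "r \<in> idealizer P" using r by (simp add: idealizer_def)
      qed
      then have "finite ((\<lambda>a. P +> a) ` G)" by (intro finite_subset[OF image_mono finP])
      \<comment> \<open>Right multiplication by \<open>g\<close> kills the image of \<open>P\<close>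
        and fixes the image of \<open>G\<close>, so for elements of \<open>G\<close> congruence
        modulo \<open>P\<close> already gives congruence modulo \<open>J\<close>.\<close>
      then have "finite ((\<lambda>a. J +> a) ` G)"
      proof (rule finite_image_refine)
        fix r s assume rs: "r \<in> G" "s \<in> G" and "P +> r = P +> s"
        have car: "r \<in> carrier R" "s \<in> carrier R" using rs by (auto simp: G_def)
        have "r \<ominus> s \<in> P"
          using coset_eq_iff[OF left_ideal_additive_subgroup[OF P(1)] car] \<open>P +> r = P +> s\<close> by simp
        then have "(J +> (r \<ominus> s)) \<otimes>\<^bsub>?A\<^esub> g = \<zero>\<^bsub>?A\<^esub>" by (intro Pg) auto
        then have "(J +> r) \<ominus>\<^bsub>?A\<^esub> (J +> s) = \<zero>\<^bsub>?A\<^esub>"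
          using \<pi>_diff[OF car] Gg[OF rs(1)] Gg[OF rs(2)] car g
          by (simp add: A.minus_eq A.l_distr A.l_minus)
        then show "J +> r = J +> s" using car by simp
      qed
      moreover have "(\<lambda>a. g \<otimes>\<^bsub>?A\<^esub> a \<otimes>\<^bsub>?A\<^esub> g) ` carrier ?A \<subseteq> (\<lambda>a. J +> a) ` G"
      proof
        fix z assume "z \<in> (\<lambda>a. g \<otimes>\<^bsub>?A\<^esub> a \<otimes>\<^bsub>?A\<^esub> g) ` carrier ?A"
        then obtain a where a: "a \<in> carrier ?A" "z = g \<otimes>\<^bsub>?A\<^esub> a \<otimes>\<^bsub>?A\<^esub> g" by auto
        then have "z \<in> carrier ?A" using g by simp
        then obtain r where "r \<in> carrier R" "z = J +> r" unfolding \<pi>_surj by auto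
        then show "z \<in> (\<lambda>a. J +> a) ` G" using a by (auto simp: G_def)
      qed
      ultimately have "finite ((\<lambda>a. g \<otimes>\<^bsub>?A\<^esub> a \<otimes>\<^bsub>?A\<^esub> g) ` carrier ?A)"
        using finite_subset by blast
      then have "g \<otimes>\<^bsub>?A\<^esub> c = g" by (rule corner[OF g gg])
      \<comment> \<open>The image \<open>c\<close> of \<open>e\<close> lies in the image of
        \<open>P\<close>, so \<open>c g = 0\<close>; with \<open>g c = g\<close> and
        \<open>c\<close> central this forces \<open>g = 0\<close>, that is,
        \<open>h = 1\<close>.\<close>
      moreover have "c \<otimes>\<^bsub>?A\<^esub> g = \<zero>\<^bsub>?A\<^esub>" using Pg eP by (simp add: ce)
      ultimately have "g = \<zero>\<^bsub>?A\<^esub>" using central[OF g] by simp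
      then have "h = J +> \<one>" using hA unfolding g_def by simp
      then show "\<one> \<in> P" using image_mem[OF P one_closed] h by simp
    qed
  qed
qed

text \<open>The substance is closure under right multiplication. For a maximal left ideal
  \<open>P\<close> not containing \<open>a\<close>, the \<open>r\<close> with \<open>r a\<close> in
  \<open>P\<close> again form a maximal left ideal, which therefore contains
  \<open>x\<close>.\<close>

lemma ideal_jacobson_radical: "ideal (jacobson_radical R) R"
proof (rule idealI')
  have D: "left_ideal P R" if "maximal_left_ideal P R" for P
    using that by (simp add: maximal_left_ideal_def)
  let ?J = "jacobson_radical R"
  show "x \<in> carrier R" if "x \<in> ?J" for x using that by (simp add: jacobson_radical_def)
  show "\<zero> \<in> ?J" using left_idealD(1)[OF D] by (simp add: jacobson_radical_def)
  show "x \<oplus> y \<in> ?J" if "x \<in> ?J" "y \<in> ?J" for x y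
    using left_idealD(2)[OF D] that by (simp add: jacobson_radical_def)
  show "a \<otimes> x \<in> ?J" if "a \<in> carrier R" "x \<in> ?J" for a x
    using left_idealD(3)[OF D] that by (simp add: jacobson_radical_def)
  show "x \<otimes> a \<in> ?J" if a: "a \<in> carrier R" and x: "x \<in> ?J" for a x
  proof -
    have xR: "x \<in> carrier R" and xP: "x \<in> P" if "maximal_left_ideal P R" for P
      using x that by (simp_all add: jacobson_radical_def)
    have "x \<otimes> a \<in> P" if P: "maximal_left_ideal P R" for P
    proof (cases "a \<in> P")
      case True
      then show ?thesis using left_idealD(3)[OF D[OF P] xR[OF P]] by blast
    next
      case False
      interpret M: left_module R "regular_module R" by (rule regular_module_left_module)
      have "M.covers (carrier R) P"
        unfolding M.covers_def left_ideal_def[symmetric]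
        using P left_idealD[OF D[OF P]]
        by (auto simp: maximal_left_ideal_def intro!: left_idealI)
      then have "maximal_left_ideal {r \<in> carrier R. r \<otimes> a \<in> P} R"
        using M.covers_transporter_maximal[of "carrier R" P a] a False
        by (simp add: regular_module_def)
      then show ?thesis using xP by blast
    qed
    then show ?thesis using x a by (simp add: jacobson_radical_def)
  qed
qed

section \<open>Finiteness modulo the square of an ideal in a noetherian ring\<close>

lemma left_noetherian_maximal:
  assumes noeth: "left_noetherian_ring R" and I: "\<Phi> I"
    and left: "\<And>K. \<Phi> K \<Longrightarrow> left_ideal K R"
  shows "\<exists>K. \<Phi> K \<and> (\<forall>L. \<Phi> L \<longrightarrow> K \<subseteq> L \<longrightarrow> L = K)"
proof (rule ccontr)
  assume no_max: "\<not> ?thesis"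
  have "\<exists>C. \<forall>n :: nat. \<Phi> (C n) \<and> C n \<subset> C (Suc n)"
  proof (rule dependent_nat_choice)
    show "\<exists>K. \<Phi> K" using I by blast
    show "\<exists>L. \<Phi> L \<and> K \<subset> L" if "\<Phi> K" for K and n :: nat
      using no_max that by blast
  qed
  then obtain C where C: "\<And>n :: nat. \<Phi> (C n)" "\<And>n. C n \<subset> C (Suc n)" by blast
  then have "\<forall>n. submodule (C n) R (regular_module R) \<and> C n \<subseteq> C (Suc n)"
    using left unfolding left_ideal_def by blast
  then obtain n where n: "\<forall>k\<ge>n. C k = C n"
    using noeth unfolding left_noetherian_ring_def noetherian_module_def by blast
  have "C (Suc n) = C n" by (rule n[rule_format]) simp
  then show False using C(2)[of n] by blast
qed

text \<open>Take a left ideal \<open>I\<close> inside \<open>J\<close> that is maximal among those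
  with \<open>e I\<close> finite modulo \<open>K\<close>. Adjoining some \<open>j\<close> in
  \<open>J\<close> keeps this finite: \<open>e (i + r j)\<close> modulo \<open>K\<close> depends
  only on \<open>e i\<close> modulo \<open>K\<close> and \<open>e r\<close> modulo \<open>J\<close>,
  as \<open>J j\<close> lies in \<open>K\<close>. In use \<open>K\<close> is the square of
  \<open>J\<close>; kept abstract, it serves unchanged in the opposite ring.\<close>

lemma finite_left_multiples_mod:
  assumes noeth: "left_noetherian_ring R" and J: "ideal J R" and K: "ideal K R"
    and JJ: "\<And>a b. a \<in> J \<Longrightarrow> b \<in> J \<Longrightarrow> a \<otimes> b \<in> K"
    and e: "e \<in> carrier R" and fin: "finite ((\<lambda>r. J +> e \<otimes> r) ` carrier R)"
  shows "finite ((\<lambda>x. K +> e \<otimes> x) ` J)"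
proof -
  have lJ: "left_ideal J R" and lK: "left_ideal K R"
    using J K by (auto simp: ideal_iff)
  note J_eq = coset_eq_iff[OF left_ideal_additive_subgroup[OF lJ]]
  note K_eq = coset_eq_iff[OF left_ideal_additive_subgroup[OF lK]]
  note JR = left_idealD(4)[OF lJ]
  define \<Phi> where "\<Phi> I \<longleftrightarrow> left_ideal I R \<and> I \<subseteq> J \<and> finite ((\<lambda>x. K +> e \<otimes> x) ` I)" for I
  have "\<Phi> {\<zero>}" unfolding \<Phi>_def using left_idealD(1)[OF lJ] by (auto intro!: left_idealI)
  then obtain I where I: "\<Phi> I" and max: "\<And>L. \<Phi> L \<Longrightarrow> I \<subseteq> L \<Longrightarrow> L = I"
    using left_noetherian_maximal[OF noeth, of \<Phi>] unfolding \<Phi>_def by metis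
  have lI: "left_ideal I R" and IJ: "I \<subseteq> J" and finI: "finite ((\<lambda>x. K +> e \<otimes> x) ` I)"
    using I by (auto simp: \<Phi>_def)
  have "J \<subseteq> I"
  proof
    fix j assume j: "j \<in> J"
    have jR: "j \<in> carrier R" using JR[OF j] .
    define L where "L = (\<lambda>(i, r). i \<oplus> r \<otimes> j) ` (I \<times> carrier R)"
    have memI: "i \<oplus> r \<otimes> j \<in> L" if "i \<in> I" "r \<in> carrier R" for i r
      using that unfolding L_def by (intro image_eqI[of _ _ "(i, r)"]) auto
    have IR: "i \<in> carrier R" if "i \<in> I" for i using left_idealD(4)[OF lI that] .
    have lL: "left_ideal L R"
    proof (rule left_idealI)
      show "x \<in> carrier R" if "x \<in> L" for x using that IR jR by (auto simp: L_def)
      show "\<zero> \<in> L" using memI[OF left_idealD(1)[OF lI] zero_closed] jR by simp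
    next
      fix x y assume "x \<in> L" "y \<in> L"
      then obtain i r i' r' where ir: "i \<in> I" "r \<in> carrier R" "i' \<in> I" "r' \<in> carrier R"
        and "x = i \<oplus> r \<otimes> j" "y = i' \<oplus> r' \<otimes> j" by (auto simp: L_def)
      then have "x \<oplus> y = (i \<oplus> i') \<oplus> (r \<oplus> r') \<otimes> j"
        using IR jR by (simp add: l_distr a_ac)
      then show "x \<oplus> y \<in> L" using memI[of "i \<oplus> i'" "r \<oplus> r'"] ir left_idealD(2)[OF lI] by simp
    next
      fix a x assume a: "a \<in> carrier R" and "x \<in> L"
      then obtain i r where ir: "i \<in> I" "r \<in> carrier R" and "x = i \<oplus> r \<otimes> j" by (auto simp: L_def)
      then have "a \<otimes> x = a \<otimes> i \<oplus> (a \<otimes> r) \<otimes> j"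
        using IR jR a by (simp add: r_distr m_assoc)
      then show "a \<otimes> x \<in> L" using memI[of "a \<otimes> i" "a \<otimes> r"] ir a left_idealD(3)[OF lI] by simp
    qed
    moreover have "L \<subseteq> J"
      using IJ left_idealD(2,3)[OF lJ] j by (auto simp: L_def)
    moreover have "finite ((\<lambda>x. K +> e \<otimes> x) ` L)"
    proof -
      let ?g = "\<lambda>(i, r). (K +> e \<otimes> i, J +> e \<otimes> r)"
      have "?g ` (I \<times> carrier R)
          \<subseteq> ((\<lambda>x. K +> e \<otimes> x) ` I) \<times> ((\<lambda>r. J +> e \<otimes> r) ` carrier R)" by auto
      then have "finite (?g ` (I \<times> carrier R))"
        by (rule finite_subset) (intro finite_cartesian_product finI fin)
      then have "finite ((\<lambda>(i, r). K +> e \<otimes> (i \<oplus> r \<otimes> j)) ` (I \<times> carrier R))"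
      proof (rule finite_image_refine)
        fix p q assume "p \<in> I \<times> carrier R" "q \<in> I \<times> carrier R" "?g p = ?g q"
        then obtain i r i' r' where p: "p = (i, r)" and q: "q = (i', r')"
          and ir: "i \<in> I" "r \<in> carrier R" "i' \<in> I" "r' \<in> carrier R"
          and eq: "K +> e \<otimes> i = K +> e \<otimes> i'" "J +> e \<otimes> r = J +> e \<otimes> r'" by auto
        have "e \<otimes> i \<ominus> e \<otimes> i' \<in> K" using eq(1) K_eq[of "e \<otimes> i" "e \<otimes> i'"] ir IR e by simp
        moreover have "(e \<otimes> r \<ominus> e \<otimes> r') \<otimes> j \<in> K"
          using eq(2) J_eq[of "e \<otimes> r" "e \<otimes> r'"] ir e by (intro JJ j) simp
        ultimately have "(e \<otimes> i \<ominus> e \<otimes> i') \<oplus> (e \<otimes> r \<ominus> e \<otimes> r') \<otimes> j \<in> K"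
          by (rule left_idealD(2)[OF lK])
        moreover have "(e \<otimes> i \<ominus> e \<otimes> i') \<oplus> (e \<otimes> r \<ominus> e \<otimes> r') \<otimes> j
            = e \<otimes> (i \<oplus> r \<otimes> j) \<ominus> e \<otimes> (i' \<oplus> r' \<otimes> j)"
          using ir IR[OF ir(1)] IR[OF ir(3)] jR e by algebra
        ultimately have "e \<otimes> (i \<oplus> r \<otimes> j) \<ominus> e \<otimes> (i' \<oplus> r' \<otimes> j) \<in> K" by simp
        then show "(case p of (i, r) \<Rightarrow> K +> e \<otimes> (i \<oplus> r \<otimes> j))
            = (case q of (i, r) \<Rightarrow> K +> e \<otimes> (i \<oplus> r \<otimes> j))"
          using K_eq[of "e \<otimes> (i \<oplus> r \<otimes> j)" "e \<otimes> (i' \<oplus> r' \<otimes> j)"] ir IR jR e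
          by (simp add: p q)
      qed
      then show ?thesis unfolding L_def image_image by (simp add: case_prod_unfold)
    qed
    ultimately have "\<Phi> L" by (simp add: \<Phi>_def)
    moreover have "I \<subseteq> L"
    proof
      fix i assume "i \<in> I"
      then show "i \<in> L" using memI[of i \<zero>] IR jR by simp
    qed
    ultimately have "L = I" by (rule max)
    moreover have "j \<in> L" using memI[OF left_idealD(1)[OF lI] one_closed] jR by simp
    ultimately show "j \<in> I" by simp
  qed
  then show ?thesis using IJ finI by simp
qed

text \<open>\<open>e J / K\<close> is a finite right module, so its annihilator is an ideal of finite index.\<close>

lemma sandwich_in_square:
  assumes noeth: "left_noetherian_ring R" and J: "ideal J R" and K: "ideal K R"
    and JJ: "\<And>a b. a \<in> J \<Longrightarrow> b \<in> J \<Longrightarrow> a \<otimes> b \<in> K"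
    and e: "e \<in> carrier R" and fin: "finite ((\<lambda>r. J +> e \<otimes> r) ` carrier R)"
    and f: "\<And>B. \<lbrakk>ideal B R; J \<subseteq> B; finite ((\<lambda>a. B +> a) ` carrier R)\<rbrakk> \<Longrightarrow> f \<in> B"
    and x: "x \<in> J"
  shows "e \<otimes> x \<otimes> f \<in> K"
proof -
  have lJ: "left_ideal J R" and lK: "left_ideal K R"
    and rJ: "\<And>x a. x \<in> J \<Longrightarrow> a \<in> carrier R \<Longrightarrow> x \<otimes> a \<in> J"
    and rK: "\<And>x a. x \<in> K \<Longrightarrow> a \<in> carrier R \<Longrightarrow> x \<otimes> a \<in> K"
    using J K by (auto simp: ideal_iff)
  note K_eq = coset_eq_iff[OF left_ideal_additive_subgroup[OF lK]]
  note JR = left_idealD(4)[OF lJ]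
  define B where "B = {a \<in> carrier R. \<forall>x\<in>J. e \<otimes> x \<otimes> a \<in> K}"
  have B: "ideal B R"
  proof (rule idealI')
    show "\<zero> \<in> B" using left_idealD(1)[OF lK] JR e by (simp add: B_def)
    show "a \<oplus> b \<in> B" if "a \<in> B" "b \<in> B" for a b
      using that left_idealD(2)[OF lK] JR e by (simp add: B_def r_distr)
    show "r \<otimes> a \<in> B" if "r \<in> carrier R" "a \<in> B" for r a
    proof -
      have "e \<otimes> y \<otimes> (r \<otimes> a) \<in> K" if y: "y \<in> J" for y
      proof -
        have "e \<otimes> (y \<otimes> r) \<otimes> a \<in> K"
          using \<open>a \<in> B\<close> rJ[OF y \<open>r \<in> carrier R\<close>] by (simp add: B_def)
        then show ?thesis
          using \<open>a \<in> B\<close> \<open>r \<in> carrier R\<close> JR[OF y] e by (simp add: B_def m_assoc)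
      qed
      then show ?thesis using \<open>a \<in> B\<close> \<open>r \<in> carrier R\<close> by (simp add: B_def)
    qed
    show "a \<otimes> r \<in> B" if "r \<in> carrier R" "a \<in> B" for r a
      using that rK JR e by (simp add: B_def m_assoc[symmetric])
  qed (simp add: B_def)
  have JB: "J \<subseteq> B"
  proof
    fix a assume a: "a \<in> J"
    have "e \<otimes> y \<otimes> a \<in> K" if y: "y \<in> J" for y
      using left_idealD(3)[OF lK e JJ[OF y a]] JR[OF y] JR[OF a] e by (simp add: m_assoc)
    then show "a \<in> B" using JR[OF a] by (simp add: B_def)
  qed
  let ?h = "\<lambda>x. K +> e \<otimes> x"
  have "finite (?h ` J)"
    by (rule finite_left_multiples_mod[OF noeth J K JJ e fin])
  then obtain X where X: "X \<subseteq> J" "finite X" "?h ` J = ?h ` X"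
    using finite_subset_image[of "?h ` J" ?h J] by blast
  have XR: "y \<in> carrier R" if "y \<in> X" for y using that X(1) JR by blast
  \<comment> \<open>Finitely many \<open>y\<close> in \<open>J\<close> represent \<open>e J\<close>
    modulo \<open>K\<close>. The function \<open>?\<phi> a\<close> records how \<open>a\<close> acts
    on them, so it takes finitely many values and determines \<open>a\<close> modulo
    \<open>B\<close>.\<close>
  let ?\<phi> = "\<lambda>a. \<lambda>y\<in>X. ?h (y \<otimes> a)"
  have "?\<phi> ` carrier R \<subseteq> X \<rightarrow>\<^sub>E ?h ` J"
    using X(1) rJ by auto
  then have "finite (?\<phi> ` carrier R)"
    by (rule finite_subset) (intro finite_PiE X(2) \<open>finite (?h ` J)\<close>)
  then have "finite ((\<lambda>a. B +> a) ` carrier R)"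
  proof (rule finite_image_refine)
    fix a b assume ab: "a \<in> carrier R" "b \<in> carrier R" and eq: "?\<phi> a = ?\<phi> b"
    have on_X: "e \<otimes> y \<otimes> (a \<ominus> b) \<in> K" if y: "y \<in> X" for y
    proof -
      have "K +> e \<otimes> (y \<otimes> a) = K +> e \<otimes> (y \<otimes> b)"
        using fun_cong[OF eq, of y] y by simp
      then have "e \<otimes> (y \<otimes> a) \<ominus> e \<otimes> (y \<otimes> b) \<in> K"
        using K_eq[of "e \<otimes> (y \<otimes> a)" "e \<otimes> (y \<otimes> b)"] XR[OF y] ab e by simp
      moreover have "e \<otimes> (y \<otimes> a) \<ominus> e \<otimes> (y \<otimes> b) = e \<otimes> y \<otimes> (a \<ominus> b)"
        using XR[OF y] ab e by algebra
      ultimately show ?thesis by simp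
    qed
    \<comment> \<open>Replace \<open>z\<close> by a representative \<open>y\<close> with
      \<open>e z\<close> and \<open>e y\<close> congruent modulo \<open>K\<close>; the error stays
      in \<open>K\<close> after right multiplication.\<close>
    have "e \<otimes> z \<otimes> (a \<ominus> b) \<in> K" if z: "z \<in> J" for z
    proof -
      have "?h z \<in> ?h ` X" using z X(3) by blast
      then obtain y where y: "y \<in> X" "K +> e \<otimes> z = K +> e \<otimes> y" by auto
      then have "e \<otimes> z \<ominus> e \<otimes> y \<in> K"
        using K_eq[of "e \<otimes> z" "e \<otimes> y"] XR[OF y(1)] JR[OF z] e by simp
      then have "(e \<otimes> z \<ominus> e \<otimes> y) \<otimes> (a \<ominus> b) \<oplus> e \<otimes> y \<otimes> (a \<ominus> b) \<in> K"
        using on_X[OF y(1)] rK ab left_idealD(2)[OF lK] by simp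
      moreover have "(e \<otimes> z \<ominus> e \<otimes> y) \<otimes> (a \<ominus> b) \<oplus> e \<otimes> y \<otimes> (a \<ominus> b) = e \<otimes> z \<otimes> (a \<ominus> b)"
        using XR[OF y(1)] JR[OF z] ab e by algebra
      ultimately show ?thesis by simp
    qed
    then have "a \<ominus> b \<in> B" using ab by (simp add: B_def)
    then show "B +> a = B +> b"
      using coset_eq_iff[OF left_ideal_additive_subgroup _ _, of B a b] B ab by (simp add: ideal_iff)
  qed
  then have "f \<in> B" by (rule f[OF B JB])
  then show ?thesis using x by (simp add: B_def)
qed

section \<open>Passage to the opposite ring\<close>

lemma opposite_ring_simps:
  "carrier (opposite_ring R) = carrier R" "\<zero>\<^bsub>opposite_ring R\<^esub> = \<zero>"
  "a \<oplus>\<^bsub>opposite_ring R\<^esub> b = a \<oplus> b" "a \<otimes>\<^bsub>opposite_ring R\<^esub> b = b \<otimes> a"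
  "I +>\<^bsub>opposite_ring R\<^esub> a = I +> a"
  by (simp_all add: opposite_ring_def a_r_coset_def r_coset_def)

lemma ideal_opposite_ring: "ideal I (opposite_ring R) \<longleftrightarrow> ideal I R"
proof -
  interpret O: ring "opposite_ring R" by (rule opposite_ring_ring[OF ring_axioms])
  show ?thesis
    unfolding ideal_iff O.ideal_iff left_ideal_iff O.left_ideal_iff opposite_ring_simps by blast
qed

text \<open>This is \<open>sandwich_in_square\<close> in the opposite ring, which has the same
  ideals and cosets. The bracketing \<open>f (x e)\<close> is the reversal of
  \<open>(e x) f\<close>.\<close>

lemma sandwich_in_square_opposite:
  assumes noeth: "right_noetherian_ring R" and J: "ideal J R" and K: "ideal K R"
    and JJ: "\<And>a b. a \<in> J \<Longrightarrow> b \<in> J \<Longrightarrow> a \<otimes> b \<in> K"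
    and e: "e \<in> carrier R" and fin: "finite ((\<lambda>r. J +> r \<otimes> e) ` carrier R)"
    and f: "\<And>B. \<lbrakk>ideal B R; J \<subseteq> B; finite ((\<lambda>a. B +> a) ` carrier R)\<rbrakk> \<Longrightarrow> f \<in> B"
    and x: "x \<in> J"
  shows "f \<otimes> (x \<otimes> e) \<in> K"
  using ring.sandwich_in_square[OF opposite_ring_ring[OF ring_axioms], of J K e f x] assms
  by (simp add: ideal_opposite_ring opposite_ring_simps right_noetherian_ring_def)

end

section \<open>Splitting off the finite part\<close>

context left_module
begin

text \<open>The radical annihilates the simple quotient \<open>N / N'\<close>: for \<open>x\<close>
  outside \<open>N'\<close>, the annihilator of its class is a maximal left ideal.\<close>

lemma covers_radical_smult:
  assumes cov: "covers N N'" and j: "j \<in> jacobson_radical R" and x: "x \<in> N"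
  shows "j \<odot>\<^bsub>M\<^esub> x \<in> N'"
proof (cases "x \<in> N'")
  case True
  then show ?thesis
    using submoduleD(3)[OF coversD(2)[OF cov]] j by (simp add: jacobson_radical_def)
next
  case False
  then have "maximal_left_ideal {r \<in> carrier R. r \<odot>\<^bsub>M\<^esub> x \<in> N'} R"
    using covers_transporter_maximal[OF cov] x by blast
  then have "j \<in> {r \<in> carrier R. r \<odot>\<^bsub>M\<^esub> x \<in> N'}"
    using j unfolding jacobson_radical_def by blast
  then show ?thesis by simp
qed

text \<open>For an ideal \<open>J\<close>, level \<open>k\<close> consists of the elements killed by
  the \<open>k\<close>-th power of \<open>J\<close>; the recursion avoids forming that
  power.\<close>

primrec annihilator_tower :: "'r set \<Rightarrow> nat \<Rightarrow> 'm set" where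
  "annihilator_tower J 0 = {\<zero>\<^bsub>M\<^esub>}"
| "annihilator_tower J (Suc k) = {x \<in> carrier M. \<forall>j\<in>J. j \<odot>\<^bsub>M\<^esub> x \<in> annihilator_tower J k}"

lemma submodule_annihilator_tower:
  assumes J: "ideal J R" shows "submodule (annihilator_tower J k) R M"
proof (induction k)
  case 0
  then show ?case by (simp add: zero_submodule)
next
  case (Suc k)
  have lJ: "left_ideal J R" and rJ: "\<And>x a. x \<in> J \<Longrightarrow> a \<in> carrier R \<Longrightarrow> x \<otimes> a \<in> J"
    using J by (auto simp: R.ideal_iff)
  note JR = R.left_idealD(4)[OF lJ]
  note D = submoduleD[OF Suc]
  show ?case
  proof (rule submoduleI)
    show "\<zero>\<^bsub>M\<^esub> \<in> annihilator_tower J (Suc k)" using D(1) JR by simp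
    show "x \<oplus>\<^bsub>M\<^esub> y \<in> annihilator_tower J (Suc k)"
      if "x \<in> annihilator_tower J (Suc k)" "y \<in> annihilator_tower J (Suc k)" for x y
      using that D(2) JR by (simp add: smult_r_distr)
    show "a \<odot>\<^bsub>M\<^esub> x \<in> annihilator_tower J (Suc k)"
      if a: "a \<in> carrier R" and x: "x \<in> annihilator_tower J (Suc k)" for a x
    proof -
      have xM: "x \<in> carrier M" using x by simp
      have "j \<odot>\<^bsub>M\<^esub> (a \<odot>\<^bsub>M\<^esub> x) \<in> annihilator_tower J k" if j: "j \<in> J" for j
      proof -
        have "(j \<otimes> a) \<odot>\<^bsub>M\<^esub> x \<in> annihilator_tower J k" using x rJ[OF j a] by simp
        then show ?thesis using JR[OF j] a xM by (simp add: smult_assoc1)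
      qed
      then show ?thesis using a xM by simp
    qed
  qed simp
qed

text \<open>Truncated subtraction is harmless at \<open>i = 0\<close>, where \<open>x\<close> is
  zero and stays zero.\<close>

lemma annihilator_tower_smult:
  assumes "x \<in> annihilator_tower J i" "j \<in> J" "J \<subseteq> carrier R"
  shows "j \<odot>\<^bsub>M\<^esub> x \<in> annihilator_tower J (i - 1)"
  using assms by (cases i) auto

text \<open>Each step of a composition series costs one more factor from the radical, so some power
  of the radical annihilates \<open>N\<close>.\<close>

lemma annihilator_tower_exhausts:
  assumes fin: "finite {N. submodule N R M}" and N: "submodule N R M"
  shows "\<exists>k. N \<subseteq> annihilator_tower (jacobson_radical R) k"
  using fin N
proof (induction rule: submodule_induct)
  case zero
  then show ?case by (intro exI[of _ 0]) simp
next
  case (cover N N')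
  then obtain k where k: "N' \<subseteq> annihilator_tower (jacobson_radical R) k" by blast
  have "x \<in> annihilator_tower (jacobson_radical R) (Suc k)" if x: "x \<in> N" for x
    using k covers_radical_smult[OF cover(1) _ x] submoduleD(4)[OF coversD(1)[OF cover(1)] x]
    by auto
  then show ?case by blast
qed

text \<open>If \<open>e J f\<close> lies in \<open>J\<^sup>2\<close> then, as \<open>e + f = 1\<close>, it lies in
  \<open>e J e J f + e J f J f\<close>, so iterating pushes it into every power of \<open>J\<close>.\<close>

lemma sandwich_annihilates:
  assumes J: "ideal J R" and e: "e \<in> carrier R" and f: "f \<in> carrier R"
    and ee: "e \<otimes> e = e" and ff: "f \<otimes> f = f" and ef: "e \<oplus> f = \<one>"
    and JJ: "\<And>x. x \<in> J \<Longrightarrow> e \<otimes> x \<otimes> f \<in> ideal_prod R J J"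
    and j: "j \<in> J" and x: "x \<in> annihilator_tower J i"
  shows "(e \<otimes> j \<otimes> f) \<odot>\<^bsub>M\<^esub> x \<in> annihilator_tower J (i - k)"
  using j x
proof (induction k arbitrary: i j x)
  have lJ: "left_ideal J R" and rJ: "\<And>x a. x \<in> J \<Longrightarrow> a \<in> carrier R \<Longrightarrow> x \<otimes> a \<in> J"
    using J by (auto simp: R.ideal_iff)
  note JR = R.left_idealD(4)[OF lJ]
  note T = submoduleD[OF submodule_annihilator_tower[OF J]]
  {
    case 0
    then show ?case using T(3) JR e f by simp
  next
    case (Suc k)
    have JRs: "J \<subseteq> carrier R" using JR by blast
    \<comment> \<open>The claim is shown for all \<open>u\<close> in the square of \<open>J\<close>,
      by induction on how \<open>u\<close> is built from products and sums.\<close>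
    have "(e \<otimes> u \<otimes> f) \<odot>\<^bsub>M\<^esub> x \<in> annihilator_tower J (i - Suc k)"
      if "u \<in> ideal_prod R J J" for u
      using that
    proof (induction rule: ideal_prod.induct)
      case (prod a b)
      have ab: "a \<in> carrier R" "b \<in> carrier R" using prod JR by auto
      have xM: "x \<in> carrier M" using T(4)[OF Suc.prems(2)] .
      \<comment> \<open>In \<open>e a e b f\<close> the induction hypothesis for \<open>b\<close>
        gains \<open>k\<close> levels, and \<open>e a\<close> gains one more.\<close>
      have "(e \<otimes> b \<otimes> f) \<odot>\<^bsub>M\<^esub> x \<in> annihilator_tower J (i - k)"
        by (rule Suc.IH[OF prod(2) Suc.prems(2)])
      then have "(e \<otimes> a) \<odot>\<^bsub>M\<^esub> ((e \<otimes> b \<otimes> f) \<odot>\<^bsub>M\<^esub> x) \<in> annihilator_tower J (i - k - 1)"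
        by (rule annihilator_tower_smult[OF _ R.left_idealD(3)[OF lJ e prod(1)] JRs])
      then have 1: "(e \<otimes> a) \<odot>\<^bsub>M\<^esub> ((e \<otimes> b \<otimes> f) \<odot>\<^bsub>M\<^esub> x) \<in> annihilator_tower J (i - Suc k)"
        by simp
      \<comment> \<open>In \<open>e a f b f\<close> the factor \<open>b f\<close> gains one level
        first, and the hypothesis for \<open>a\<close>, used at \<open>i - 1\<close>, gains the
        other \<open>k\<close>.\<close>
      have "(b \<otimes> f) \<odot>\<^bsub>M\<^esub> x \<in> annihilator_tower J (i - 1)"
        by (rule annihilator_tower_smult[OF Suc.prems(2) rJ[OF prod(2) f] JRs])
      then have "(e \<otimes> a \<otimes> f) \<odot>\<^bsub>M\<^esub> ((b \<otimes> f) \<odot>\<^bsub>M\<^esub> x) \<in> annihilator_tower J (i - 1 - k)"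
        by (rule Suc.IH[OF prod(1)])
      then have 2: "(e \<otimes> a \<otimes> f) \<odot>\<^bsub>M\<^esub> ((b \<otimes> f) \<odot>\<^bsub>M\<^esub> x) \<in> annihilator_tower J (i - Suc k)"
        by simp
      have "e \<otimes> (a \<otimes> b) \<otimes> f = e \<otimes> a \<otimes> (e \<oplus> f) \<otimes> (b \<otimes> f)"
        unfolding ef using ab e f by (simp add: R.m_assoc)
      also have "\<dots> = (e \<otimes> a) \<otimes> (e \<otimes> b \<otimes> f) \<oplus> (e \<otimes> a \<otimes> f) \<otimes> (b \<otimes> f)"
        using ab e f by algebra
      finally have "(e \<otimes> (a \<otimes> b) \<otimes> f) \<odot>\<^bsub>M\<^esub> x
          = (e \<otimes> a) \<odot>\<^bsub>M\<^esub> ((e \<otimes> b \<otimes> f) \<odot>\<^bsub>M\<^esub> x) \<oplus>\<^bsub>M\<^esub> (e \<otimes> a \<otimes> f) \<odot>\<^bsub>M\<^esub> ((b \<otimes> f) \<odot>\<^bsub>M\<^esub> x)"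
        using ab e f xM by (simp only: smult_l_distr smult_assoc1 R.m_closed)
      then show ?case using T(2)[OF 1 2] by simp
    next
      case (sum u v)
      have uv: "u \<in> carrier R" "v \<in> carrier R"
        using sum(1,2) R.ideal_prod_in_carrier[OF J J] by auto
      have "e \<otimes> (u \<oplus> v) \<otimes> f = e \<otimes> u \<otimes> f \<oplus> e \<otimes> v \<otimes> f" using uv e f by algebra
      then show ?case
        using T(2)[OF sum(3,4)] uv e f T(4)[OF Suc.prems(2)] by (simp add: smult_l_distr)
    qed
    \<comment> \<open>By \<open>JJ\<close>, \<open>e j f\<close> lies in the square of
      \<open>J\<close>; sandwiching it once more changes nothing, since \<open>e\<close> and
      \<open>f\<close> are idempotent.\<close>
    from this[OF JJ[OF Suc.prems(1)]]
    have "(e \<otimes> (e \<otimes> j \<otimes> f) \<otimes> f) \<odot>\<^bsub>M\<^esub> x \<in> annihilator_tower J (i - Suc k)" .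
    moreover have "e \<otimes> (e \<otimes> j \<otimes> f) \<otimes> f = (e \<otimes> e) \<otimes> j \<otimes> (f \<otimes> f)"
      using JR[OF Suc.prems(1)] e f by algebra
    ultimately show ?case by (simp add: ee ff)
  }
qed

text \<open>For idempotent \<open>e\<close> this set is \<open>e M\<close>. If
  \<open>e x = x\<close>, then \<open>a x = a e x\<close>, and as the component
  \<open>(1 - e) a e x\<close> vanishes, \<open>a x = e a x\<close>.\<close>

lemma submodule_fixed_points:
  assumes e: "e \<in> carrier R"
    and stable: "\<And>a x. \<lbrakk>a \<in> carrier R; x \<in> carrier M\<rbrakk> \<Longrightarrow> ((\<one> \<ominus> e) \<otimes> a \<otimes> e) \<odot>\<^bsub>M\<^esub> x = \<zero>\<^bsub>M\<^esub>"
  shows "submodule {x \<in> carrier M. e \<odot>\<^bsub>M\<^esub> x = x} R M"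
proof (rule submoduleI)
  fix a x assume a: "a \<in> carrier R" and x: "x \<in> {x \<in> carrier M. e \<odot>\<^bsub>M\<^esub> x = x}"
  then have xM: "x \<in> carrier M" and ex: "e \<odot>\<^bsub>M\<^esub> x = x" by auto
  have "a \<otimes> e = (\<one> \<ominus> e) \<otimes> a \<otimes> e \<oplus> e \<otimes> a \<otimes> e"
  proof -
    have "(\<one> \<ominus> e) \<otimes> a \<otimes> e \<oplus> e \<otimes> a \<otimes> e = ((\<one> \<ominus> e) \<oplus> e) \<otimes> a \<otimes> e"
      using a e by (simp add: R.l_distr)
    then show ?thesis using a e by (simp add: R.minus_eq R.a_assoc R.l_neg)
  qed
  then have "(a \<otimes> e) \<odot>\<^bsub>M\<^esub> x = ((\<one> \<ominus> e) \<otimes> a \<otimes> e \<oplus> e \<otimes> a \<otimes> e) \<odot>\<^bsub>M\<^esub> x" by simp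
  also have "\<dots> = (e \<otimes> a \<otimes> e) \<odot>\<^bsub>M\<^esub> x"
    using smult_l_distr[of "(\<one> \<ominus> e) \<otimes> a \<otimes> e" "e \<otimes> a \<otimes> e" x] stable[OF a xM] a e xM by simp
  finally have "a \<odot>\<^bsub>M\<^esub> x = e \<odot>\<^bsub>M\<^esub> (a \<odot>\<^bsub>M\<^esub> x)"
    using a e xM ex by (simp add: smult_assoc1)
  then show "a \<odot>\<^bsub>M\<^esub> x \<in> {x \<in> carrier M. e \<odot>\<^bsub>M\<^esub> x = x}" using a xM by simp
qed (use e in \<open>auto simp: smult_r_distr\<close>)

text \<open>Climb a composition series. If \<open>N\<close> is generated over \<open>N'\<close> by
  \<open>x = e x\<close>, the radical sends \<open>x\<close> into \<open>N'\<close>, so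
  \<open>r x\<close> modulo \<open>N'\<close> depends only on \<open>r e\<close> modulo the radical,
  which takes finitely many values.\<close>

lemma finite_submodule_of_fixed_points:
  assumes fin: "finite {N. submodule N R M}" and e: "e \<in> carrier R"
    and finR: "finite ((\<lambda>r. jacobson_radical R +>\<^bsub>R\<^esub> r \<otimes> e) ` carrier R)"
    and N: "submodule N R M" and fixed: "N \<subseteq> {x \<in> carrier M. e \<odot>\<^bsub>M\<^esub> x = x}"
  shows "finite N"
  using fin N fixed
proof (induction rule: submodule_induct)
  case (cover N N')
  let ?J = "jacobson_radical R"
  note N' = submoduleD[OF coversD(2)[OF cover(1)]]
  have "finite N'" using cover coversD(3)[OF cover(1)] by blast
  obtain x where x: "x \<in> N" "x \<notin> N'" using coversD(3)[OF cover(1)] by blast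
  have xM: "x \<in> carrier M" and ex: "e \<odot>\<^bsub>M\<^esub> x = x" using x cover.prems by auto
  obtain T where T: "T \<subseteq> carrier R" "finite T"
    "(\<lambda>r. ?J +>\<^bsub>R\<^esub> r \<otimes> e) ` carrier R = (\<lambda>r. ?J +>\<^bsub>R\<^esub> r \<otimes> e) ` T"
    using finite_subset_image[OF finR order_refl] by blast
  have "N \<subseteq> (\<lambda>(n, t). n \<oplus>\<^bsub>M\<^esub> t \<odot>\<^bsub>M\<^esub> x) ` (N' \<times> T)"
  proof
    fix z assume "z \<in> N"
    then have "z \<in> N' <+>\<^bsub>M\<^esub> cyclic x" using covers_sum_cyclic[OF cover(1)] x by simp
    then obtain n r where n: "n \<in> N'" and r: "r \<in> carrier R" and z: "z = n \<oplus>\<^bsub>M\<^esub> r \<odot>\<^bsub>M\<^esub> x"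
      by (auto simp: set_add_def' cyclic_def)
    have "?J +>\<^bsub>R\<^esub> r \<otimes> e \<in> (\<lambda>r. ?J +>\<^bsub>R\<^esub> r \<otimes> e) ` T" using r T(3) by blast
    then obtain t where t: "t \<in> T" "?J +>\<^bsub>R\<^esub> r \<otimes> e = ?J +>\<^bsub>R\<^esub> t \<otimes> e" by auto
    have tR: "t \<in> carrier R" using t T(1) by blast
    have "r \<otimes> e \<ominus> t \<otimes> e \<in> ?J"
      using t(2) R.coset_eq_iff[of ?J "r \<otimes> e" "t \<otimes> e"] r tR e
        ideal.axioms(1)[OF R.ideal_jacobson_radical] by simp
    then have "(r \<otimes> e \<ominus> t \<otimes> e) \<odot>\<^bsub>M\<^esub> x \<in> N'" by (rule covers_radical_smult[OF cover(1) _ x(1)])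
    then have "r \<odot>\<^bsub>M\<^esub> x \<ominus>\<^bsub>M\<^esub> t \<odot>\<^bsub>M\<^esub> x \<in> N'"
      using r tR e xM ex by (simp add: smult_diff_left smult_assoc1)
    then have *: "n \<oplus>\<^bsub>M\<^esub> (r \<odot>\<^bsub>M\<^esub> x \<ominus>\<^bsub>M\<^esub> t \<odot>\<^bsub>M\<^esub> x) \<in> N'" by (rule N'(2)[OF n])
    have "z = n \<oplus>\<^bsub>M\<^esub> (r \<odot>\<^bsub>M\<^esub> x \<ominus>\<^bsub>M\<^esub> t \<odot>\<^bsub>M\<^esub> x) \<oplus>\<^bsub>M\<^esub> t \<odot>\<^bsub>M\<^esub> x"
      using N'(4)[OF n] r tR xM by (simp add: z M.minus_eq M.a_assoc M.l_neg)
    then show "z \<in> (\<lambda>(n, t). n \<oplus>\<^bsub>M\<^esub> t \<odot>\<^bsub>M\<^esub> x) ` (N' \<times> T)"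
      using * t(1) by (intro image_eqI[of _ _ "(n \<oplus>\<^bsub>M\<^esub> (r \<odot>\<^bsub>M\<^esub> x \<ominus>\<^bsub>M\<^esub> t \<odot>\<^bsub>M\<^esub> x), t)"]) auto
  qed
  then show ?case
    by (rule finite_subset) (intro finite_imageI finite_cartesian_product \<open>finite N'\<close> T(2))
qed simp

text \<open>Submodules of \<open>D\<close> are submodules of \<open>M\<close> inside
  \<open>D\<close>, with the same sums and intersections, so the argument can be carried out in
  \<open>M\<close>.\<close>

lemma restrict_distributive:
  assumes D: "submodule D R M"
    and comp: "\<And>x y. x \<in> D \<Longrightarrow> y \<in> D \<Longrightarrow> comparable x y"
  shows "distributive_module R (M\<lparr>carrier := D\<rparr>)"
proof -
  have sub: "submodule N R M \<and> N \<subseteq> D" if N: "submodule N R (M\<lparr>carrier := D\<rparr>)" for N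
  proof -
    interpret N: submodule N R "M\<lparr>carrier := D\<rparr>" by fact
    have ND: "N \<subseteq> D" using N.subset by simp
    have "submodule N R M"
    proof (rule submoduleI)
      show "x \<in> carrier M" if "x \<in> N" for x using ND submoduleD(4)[OF D] that by blast
      show "\<zero>\<^bsub>M\<^esub> \<in> N" using N.one_closed by simp
      show "x \<oplus>\<^bsub>M\<^esub> y \<in> N" if "x \<in> N" "y \<in> N" for x y using N.m_closed[OF that] by simp
      show "a \<odot>\<^bsub>M\<^esub> x \<in> N" if "a \<in> carrier R" "x \<in> N" for a x
        using N.smult_closed[OF that] by simp
    qed
    with ND show ?thesis by simp
  qed
  show ?thesis
    unfolding distributive_module_def
  proof (intro allI impI)
    fix A B C
    assume "submodule A R (M\<lparr>carrier := D\<rparr>)" "submodule B R (M\<lparr>carrier := D\<rparr>)"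
      "submodule C R (M\<lparr>carrier := D\<rparr>)"
    then have A: "submodule A R M" and B: "submodule B R M" "B \<subseteq> D"
      and C: "submodule C R M" "C \<subseteq> D" by (simp_all add: sub)
    have "comparable b c" if "b \<in> B" "c \<in> C" for b c
      by (rule comp) (use that B(2) C(2) in auto)
    then have "A \<inter> (B <+>\<^bsub>M\<^esub> C) = (A \<inter> B) <+>\<^bsub>M\<^esub> (A \<inter> C)"
      by (rule inter_sum_distrib[OF A B(1) C(1)])
    then show "A \<inter> (B <+>\<^bsub>M\<lparr>carrier := D\<rparr>\<^esub> C)
        = (A \<inter> B) <+>\<^bsub>M\<lparr>carrier := D\<rparr>\<^esub> (A \<inter> C)"
      by (simp add: set_add_def')
  qed
qed

text \<open>The summands are the fixed points of \<open>e\<close> and of \<open>f = 1 - e\<close>.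
  They are submodules because \<open>e R f\<close> and \<open>f R e\<close> act as zero on
  \<open>M\<close>.\<close>

theorem finite_distributive_decomposition:
  assumes sp: "semiperfect_ring R" and ln: "left_noetherian_ring R"
    and rn: "right_noetherian_ring R" and fin: "finite {N. submodule N R M}"
  shows "\<exists>F D. internal_direct_sum R M F D \<and> finite F \<and>
           distributive_module R (M\<lparr>carrier := D\<rparr>)"
proof -
  let ?J = "jacobson_radical R"
  note J = R.ideal_jacobson_radical
  have lJ: "left_ideal ?J R" using J by (simp add: R.ideal_iff)
  note JR = R.left_idealD(4)[OF lJ]
  have ss: "semisimple_ring (R Quot ?J)" and lift: "idempotents_lift_modulo R ?J"
    using sp by (auto simp: semiperfect_ring_def)
  show ?thesis
  proof (rule R.coset_finite_part_lift[OF J ss lift])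
    fix e
    assume e: "e \<in> carrier R" "e \<otimes> e = e"
      and comm: "\<And>r. r \<in> carrier R \<Longrightarrow> e \<otimes> r \<ominus> r \<otimes> e \<in> ?J"
      and fin_right: "finite ((\<lambda>r. ?J +>\<^bsub>R\<^esub> r \<otimes> e) ` carrier R)"
      and index: "\<And>B. \<lbrakk>ideal B R; ?J \<subseteq> B; finite ((\<lambda>a. B +>\<^bsub>R\<^esub> a) ` carrier R)\<rbrakk> \<Longrightarrow> \<one> \<ominus> e \<in> B"
      and proper: "\<And>P. \<lbrakk>left_ideal P R; ?J \<subseteq> P; e \<in> P;
        finite ((\<lambda>a. P +>\<^bsub>R\<^esub> a) ` R.idealizer P)\<rbrakk> \<Longrightarrow> \<one> \<in> P"
    define f where "f = \<one> \<ominus> e"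
    have f: "f \<in> carrier R" using e(1) by (simp add: f_def)
    have ef1: "e \<oplus> f = \<one>" "f \<oplus> e = \<one>"
      using e(1) by (simp_all add: f_def R.minus_eq R.a_assoc R.l_neg R.a_comm[of e])
    have ef0: "e \<otimes> f = \<zero>"
      using e by (simp add: f_def R.minus_eq R.r_distr R.r_minus R.r_neg)
    have fe0: "f \<otimes> e = \<zero>"
      using e by (simp add: f_def R.minus_eq R.l_distr R.l_minus R.r_neg)
    have "f \<otimes> f = f \<ominus> f \<otimes> e"
      using e(1) f by (simp add: f_def R.minus_eq R.r_distr R.r_minus)
    then have ff: "f \<otimes> f = f" using f by (simp add: fe0 R.minus_eq)
    have e_eq: "\<one> \<ominus> f = e"
      using e(1) by (simp add: f_def R.minus_eq R.minus_add R.a_assoc[symmetric] R.r_neg)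
    have "?J +>\<^bsub>R\<^esub> e \<otimes> r = ?J +>\<^bsub>R\<^esub> r \<otimes> e" if r: "r \<in> carrier R" for r
      using R.coset_eq_iff[OF ideal.axioms(1)[OF J], of "e \<otimes> r" "r \<otimes> e"] comm[OF r] r e(1) by simp
    then have fin_left: "finite ((\<lambda>r. ?J +>\<^bsub>R\<^esub> e \<otimes> r) ` carrier R)"
      using fin_right by simp
    have K: "ideal (ideal_prod R ?J ?J) R" by (rule R.ideal_prod_is_ideal[OF J J])
    have JJ_ef: "e \<otimes> x \<otimes> f \<in> ideal_prod R ?J ?J" if "x \<in> ?J" for x
      unfolding f_def
      by (rule R.sandwich_in_square[OF ln J K ideal_prod.prod e(1) fin_left index that])
    have JJ_fe: "f \<otimes> x \<otimes> e \<in> ideal_prod R ?J ?J" if x: "x \<in> ?J" for x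
    proof -
      have "f \<otimes> (x \<otimes> e) \<in> ideal_prod R ?J ?J"
        unfolding f_def
        by (rule R.sandwich_in_square_opposite[OF rn J K ideal_prod.prod e(1) fin_right index x])
      then show ?thesis using f e(1) JR[OF x] by (simp add: R.m_assoc)
    qed
    obtain n where n: "carrier M \<subseteq> annihilator_tower ?J n"
      using annihilator_tower_exhausts[OF fin carrier_submodule] by blast
    have efM: "(e \<otimes> a \<otimes> f) \<odot>\<^bsub>M\<^esub> x = \<zero>\<^bsub>M\<^esub>" if a: "a \<in> carrier R" and x: "x \<in> carrier M" for a x
    proof -
      \<comment> \<open>\<open>e\<close> commutes with \<open>a\<close> modulo the radical, so
        \<open>e a f\<close> lies in the radical; going down \<open>n\<close> levels from level
        \<open>n\<close> then reaches the zero submodule.\<close>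
      have "e \<otimes> (e \<otimes> a \<ominus> a \<otimes> e) = (e \<otimes> e) \<otimes> a \<ominus> e \<otimes> a \<otimes> e" using a e(1) by algebra
      also have "\<dots> = e \<otimes> a \<otimes> f"
        using a e by (simp add: f_def R.minus_eq R.r_distr R.r_minus)
      finally have "e \<otimes> a \<otimes> f \<in> ?J" using R.left_idealD(3)[OF lJ e(1) comm[OF a]] by simp
      then have "(e \<otimes> (e \<otimes> a \<otimes> f) \<otimes> f) \<odot>\<^bsub>M\<^esub> x \<in> annihilator_tower ?J (n - n)"
        using n x by (intro sandwich_annihilates[OF J e(1) f e(2) ff ef1(1) JJ_ef]) auto
      moreover have "e \<otimes> (e \<otimes> a \<otimes> f) \<otimes> f = (e \<otimes> e) \<otimes> a \<otimes> (f \<otimes> f)" using a e(1) f by algebra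
      ultimately show ?thesis by (simp add: e(2) ff)
    qed
    have feM: "(f \<otimes> a \<otimes> e) \<odot>\<^bsub>M\<^esub> x = \<zero>\<^bsub>M\<^esub>" if a: "a \<in> carrier R" and x: "x \<in> carrier M" for a x
    proof -
      \<comment> \<open>The same commutator, now multiplied by \<open>e\<close> on the right and
        negated, produces \<open>f a e\<close>.\<close>
      have "\<ominus> ((e \<otimes> a \<ominus> a \<otimes> e) \<otimes> e) = a \<otimes> (e \<otimes> e) \<ominus> e \<otimes> a \<otimes> e" using a e(1) by algebra
      also have "\<dots> = f \<otimes> a \<otimes> e"
        using a e by (simp add: f_def R.minus_eq R.l_distr R.l_minus)
      moreover have "\<ominus> ((e \<otimes> a \<ominus> a \<otimes> e) \<otimes> e) \<in> ?J"
        using J comm[OF a] e(1) by (intro R.left_ideal_uminus[OF lJ]) (simp add: R.ideal_iff)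
      ultimately have "f \<otimes> a \<otimes> e \<in> ?J" by simp
      then have "(f \<otimes> (f \<otimes> a \<otimes> e) \<otimes> e) \<odot>\<^bsub>M\<^esub> x \<in> annihilator_tower ?J (n - n)"
        using n x by (intro sandwich_annihilates[OF J f e(1) ff e(2) ef1(2) JJ_fe]) auto
      moreover have "f \<otimes> (f \<otimes> a \<otimes> e) \<otimes> e = (f \<otimes> f) \<otimes> a \<otimes> (e \<otimes> e)" using a e(1) f by algebra
      ultimately show ?thesis by (simp add: e(2) ff)
    qed
    let ?F = "{x \<in> carrier M. e \<odot>\<^bsub>M\<^esub> x = x}" and ?D = "{x \<in> carrier M. f \<odot>\<^bsub>M\<^esub> x = x}"
    have F: "submodule ?F R M"
      using submodule_fixed_points[OF e(1)] feM by (simp add: f_def)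
    have D: "submodule ?D R M"
      using submodule_fixed_points[OF f] efM by (simp add: e_eq)
    have eD: "e \<odot>\<^bsub>M\<^esub> x = \<zero>\<^bsub>M\<^esub>" if "x \<in> ?D" for x
    proof -
      have xM: "x \<in> carrier M" and "f \<odot>\<^bsub>M\<^esub> x = x" using that by auto
      then have "e \<odot>\<^bsub>M\<^esub> x = (e \<otimes> f) \<odot>\<^bsub>M\<^esub> x" using e(1) f by (simp add: smult_assoc1)
      then show ?thesis using xM by (simp add: ef0)
    qed
    have "?F <+>\<^bsub>M\<^esub> ?D = carrier M"
    proof
      show "?F <+>\<^bsub>M\<^esub> ?D \<subseteq> carrier M" by (auto simp: set_add_def')
      show "carrier M \<subseteq> ?F <+>\<^bsub>M\<^esub> ?D"
      proof
        fix x assume x: "x \<in> carrier M"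
        have "e \<odot>\<^bsub>M\<^esub> x \<in> ?F" using x e by (simp add: smult_assoc1[symmetric])
        moreover have "f \<odot>\<^bsub>M\<^esub> x \<in> ?D" using x f ff by (simp add: smult_assoc1[symmetric])
        moreover have "x = e \<odot>\<^bsub>M\<^esub> x \<oplus>\<^bsub>M\<^esub> f \<odot>\<^bsub>M\<^esub> x"
          using x e(1) f ef1(1) by (simp add: smult_l_distr[symmetric])
        ultimately show "x \<in> ?F <+>\<^bsub>M\<^esub> ?D" unfolding set_add_def' by blast
      qed
    qed
    moreover have "?F \<inter> ?D = {\<zero>\<^bsub>M\<^esub>}"
    proof
      show "?F \<inter> ?D \<subseteq> {\<zero>\<^bsub>M\<^esub>}"
      proof
        fix x assume "x \<in> ?F \<inter> ?D"
        then show "x \<in> {\<zero>\<^bsub>M\<^esub>}" using eD[of x] by auto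
      qed
      show "{\<zero>\<^bsub>M\<^esub>} \<subseteq> ?F \<inter> ?D" using e(1) f by simp
    qed
    ultimately have "internal_direct_sum R M ?F ?D"
      using F D by (simp add: internal_direct_sum_def)
    moreover have "finite ?F"
      by (rule finite_submodule_of_fixed_points[OF fin e(1) fin_right F order_refl])
    moreover have "distributive_module R (M\<lparr>carrier := ?D\<rparr>)"
    proof (rule restrict_distributive[OF D], rule ccontr)
      fix x y assume x: "x \<in> ?D" and y: "y \<in> ?D" and "\<not> comparable x y"
      then have xM: "x \<in> carrier M" and yM: "y \<in> carrier M" by auto
      show False
      proof (rule not_comparable_finite_idealizer[OF fin xM yM \<open>\<not> comparable x y\<close>])
        fix P
        assume P: "maximal_left_ideal P R" and finP: "finite ((\<lambda>a. P +>\<^bsub>R\<^esub> a) ` R.idealizer P)"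
          and xP: "\<And>r. r \<in> carrier R \<Longrightarrow> r \<odot>\<^bsub>M\<^esub> x \<in> cyclic y \<Longrightarrow> r \<in> P"
        have lP: "left_ideal P R" and "P \<noteq> carrier R"
          using P by (auto simp: maximal_left_ideal_def)
        \<comment> \<open>\<open>e x = 0\<close> lies in \<open>R y\<close>, so \<open>e\<close> is
          in the first transporter; \<open>proper\<close> then makes \<open>P\<close> the whole
          ring.\<close>
        have "e \<in> P"
          using xP[OF e(1)] eD[OF x] submoduleD(1)[OF submodule_cyclic[OF yM]] by simp
        moreover have "?J \<subseteq> P" using P by (auto simp: jacobson_radical_def)
        ultimately have "\<one> \<in> P" using proper[OF lP] finP by simp
        then have "a \<in> P" if "a \<in> carrier R" for a
          using R.left_idealD(3)[OF lP that] that by (metis R.r_one)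
        then show False using \<open>P \<noteq> carrier R\<close> R.left_idealD(4)[OF lP] by blast
      qed
    qed
    ultimately show ?thesis by blast
  qed
qed

end

theorem mainTheorem4:
  fixes R :: "('r, 'e) ring_scheme"
  assumes "ring R"
  shows
    "((\<forall>S :: ('r, 'r set) module. left_module R S \<and> simple_module R S \<longrightarrow>
          infinite (carrier (endo_ring R S))) \<longrightarrow>
      (\<forall>M :: ('r, 'm, 'x) module_scheme. left_module R M \<and> finite {N. submodule N R M} \<longrightarrow>
          distributive_module R M)) \<and>
     (semiperfect_ring R \<and> left_noetherian_ring R \<and> right_noetherian_ring R \<longrightarrow>
      (\<forall>M :: ('r, 'm, 'x) module_scheme. left_module R M \<and> finite {N. submodule N R M} \<longrightarrow>
          (\<exists>F D. internal_direct_sum R M F D \<and> finite F \<and>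
             distributive_module R (M\<lparr>carrier := D\<rparr>))))"
  using distributive_if_infinite_endomorphisms left_module.finite_distributive_decomposition
  by (intro conjI impI allI) blast+

end
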